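(* Let $d\geq1$ and let $K\subseteq\mathbb{R}^d$ be compact. (a) Let $f:K\rightrightarrows\mathbb{R}$ be a total multifunction that is computable relative to an oracle $\mathcal{O}$. Then there exists $g:K\rightrightarrows\mathbb{R}$ tightening $f$ which is still computable relative to $\mathcal{O}$ and which maps compact sets to compact sets. (b) If a total multifunction $f:K\rightrightarrows\mathbb{R}$ is relatively computable (computable relative to some oracle), then it is $\omega$-fold Henkin-continuous. (c) Suppose a total multifunction $f:K\rightrightarrows\mathbb{R}$ maps compact sets to compact sets and is $\omega$-fold Henkin-continuous. Then $f$ is relatively computable.
   Context: Multifunctions. A multifunction $f:\subseteq X\rightrightarrows Y$ is a relation $f\subseteq X\times Y$; $f(x)=\{y:(x,y)\in f\}$, $\mathrm{dom}(f)=\{x:f(x)\neq\emptyset\}$, $f[S]=\bigcup_{x\in S}f(x)$. It is total (written $f:X\rightrightarrows Y$) if $\mathrm{dom}(f)=X$. $g$ tightens $f$ if $\mathrm{dom}(f)\subseteq\mathrm{dom}(g)$ and $g(x)\subseteq f(x)$ for all $x\in\mathrm{dom}(f)$. "$f$ maps compact sets to compact sets" means $f[S]$ is compact for every compact $S\subseteq\mathrm{dom}(f)$. Relative computability. $f:\subseteq\mathbb{R}^d\rightrightarrows\mathbb{R}$ is computable relative to an oracle $\mathcal O\subseteq\{0,1\}^*$ if some Turing machine with oracle $\mathcal O$, given any sequence $(q_n)$ in $\mathbb{Q}^d$ with $\|x-q_n\|_\infty\le2^{-n}$ for all $n\in\mathbb N$ and some $x\in\mathrm{dom}(f)$, outputs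 a sequence $(p_m)$ in $\mathbb{Q}$ with $|y-p_m|\le2^{-m}$ for all $m\in\mathbb N$ and some $y\in f(x)$ (where $y$ may depend on the given sequence and not only on $x$). $\omega$-fold Henkin-continuity. Let $\overline{B}(z,r)$ denote the closed ball. A total multifunction $f:X\rightrightarrows Y$ between metric spaces is $\omega$-fold Henkin-continuous if the infinitary formula $$\exists\delta_1,\delta_2,\ldots>0\ \ \forall x_1\in X\,\exists y_1\in Y\ \forall x_2\in X\,\exists y_2\in Y\cdots\forall x_\ell\in X\,\exists y_\ell\in Y\cdots:$$ $$y_1\in f(x_1)\ \wedge\ \bigwedge_{\ell\ge1}\Big(x_{\ell+1}\in\overline{B}(x_\ell,\delta_\ell)\rightarrow y_{\ell+1}\in f(x_{\ell+1})\cap\overline{B}(y_\ell,2^{-\ell})\Big)$$ holds, with the semantics of an infinite two-player game: there are a sequence $(\delta_\ell)_{\ell\ge1}$ of positive reals and a strategy, i.e. functions $\eta_\ell:X^\ell\to Y$ ($\ell\ge1$), such that for every sequence $(x_\ell)_{\ell\ge1}$ in $X$ the points $y_\ell:=\eta_\ell(x_1,\dots,x_\ell)$ satisfy the displayed conjunction. *)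

theory Defs
  imports "HOL-Analysis.Analysis" "HOL-Library.Sublist"
begin

section \<open>Multifunctions\<close>

text \<open>
  A multifunction is a relation \<open>f :: ('a \<times> 'b) set\<close>; then \<open>f `` {x}\<close> is its value
  at \<open>x\<close>, \<open>Domain f\<close> its domain and \<open>f `` S\<close> the image of \<open>S\<close>.  A total multifunction on
  \<open>X\<close> is one with \<open>Domain f = X\<close>.
\<close>

definition tightens :: "('a \<times> 'b) set \<Rightarrow> ('a \<times> 'b) set \<Rightarrow> bool" where
  "tightens g f \<longleftrightarrow> Domain f \<subseteq> Domain g \<and> (\<forall>x\<in>Domain f. g `` {x} \<subseteq> f `` {x})"

definition maps_compact_to_compact ::
  "('a::topological_space \<times> 'b::topological_space) set \<Rightarrow> bool" where
  "maps_compact_to_compact f \<longleftrightarrow> (\<forall>S. S \<subseteq> Domain f \<and> compact S \<longrightarrow> compact (f `` S))"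

text \<open>
  The game takes place on \<open>X = Domain f\<close>, so \<open>f\<close> is total.  Positions are numbered from 1, and
  the strategies \<open>\<eta>\<^sub>l : X\<^sup>l \<Rightarrow> Y\<close> are the restrictions of one function \<open>\<eta>\<close> to lists of length \<open>l\<close>.
\<close>

definition omega_henkin_continuous ::
  "('a::metric_space \<times> 'b::metric_space) set \<Rightarrow> bool" where
  "omega_henkin_continuous f \<longleftrightarrow>
     (\<exists>\<delta> :: nat \<Rightarrow> real. (\<forall>l\<ge>1. \<delta> l > 0) \<and>
       (\<exists>\<eta> :: 'a list \<Rightarrow> 'b. \<forall>x :: nat \<Rightarrow> 'a. (\<forall>l\<ge>1. x l \<in> Domain f) \<longrightarrow>
         (let y = (\<lambda>l. \<eta> (map x [1..<Suc l])) in
            y 1 \<in> f `` {x 1} \<and>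
            (\<forall>l\<ge>1. x (Suc l) \<in> cball (x l) (\<delta> l) \<longrightarrow>
               y (Suc l) \<in> f `` {x (Suc l)} \<inter> cball (y l) (1 / 2 ^ l)))))"


section \<open>Oracle Turing machines on infinite words\<close>

text \<open>
  Multitape oracle machines with a one-way read-only input tape holding an infinite word, a
  one-way write-only output tape, a write-only query tape over \<open>{0,1}\<close> that is erased by each
  query, and finitely many two-way infinite work tapes.  States and work symbols are initial
  segments of the natural numbers; 0 is the initial state and the blank symbol.  Entering the
  state \<open>ask\<close> queries the oracle, which sends the machine to state \<open>yes\<close> or \<open>no\<close>.
\<close>

datatype io_symbol = Stroke | Minus | Slash | End

datatype move = Left | Stay | Right

record action =
  goto :: nat
  writes :: "nat list"  \<comment> \<open>one symbol for each work tape\<close>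
  moves :: "move list"  \<comment> \<open>one move for each work tape\<close>
  advance :: bool  \<comment> \<open>whether to move the input head to the next cell\<close>
  emit :: "io_symbol option"  \<comment> \<open>symbol to append to the output tape, if any\<close>
  enter :: "bool option"  \<comment> \<open>bit to append to the query tape, if any\<close>

text \<open>
  The arguments of \<open>delta\<close> are the current state, the scanned input symbol and the list of symbols
  scanned on the work tapes.
\<close>

record machine =
  num_states :: nat
  num_symbols :: nat
  num_tapes :: nat
  ask :: nat
  yes :: nat
  no :: nat
  delta :: "nat \<Rightarrow> io_symbol \<Rightarrow> nat list \<Rightarrow> action"

text \<open>
  The closure condition makes the reachable part of \<open>delta\<close> a finite table, so that no
  noncomputable information can be hidden in it.
\<close>

definition turing_machine :: "machine \<Rightarrow> bool" where
  "turing_machine M \<longleftrightarrow>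
     0 < num_states M \<and> 0 < num_symbols M \<and>
     ask M < num_states M \<and> yes M < num_states M \<and> no M < num_states M \<and>
     (\<forall>s c rs. s < num_states M \<and> length rs = num_tapes M \<and> set rs \<subseteq> {..<num_symbols M} \<longrightarrow>
        goto (delta M s c rs) < num_states M \<and>
        length (writes (delta M s c rs)) = num_tapes M \<and>
        set (writes (delta M s c rs)) \<subseteq> {..<num_symbols M} \<and>
        length (moves (delta M s c rs)) = num_tapes M)"

type_synonym tape = "(int \<Rightarrow> nat) \<times> int"  \<comment> \<open>contents and head position\<close>

definition read_tape :: "tape \<Rightarrow> nat" where
  "read_tape T = fst T (snd T)"

definition update_tape :: "tape \<Rightarrow> nat \<Rightarrow> move \<Rightarrow> tape" where
  "update_tape T a m =
     ((fst T)(snd T := a),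
      snd T + (case m of Left \<Rightarrow> - 1 | Stay \<Rightarrow> 0 | Right \<Rightarrow> 1))"

record config =
  state :: nat
  position :: nat  \<comment> \<open>input head\<close>
  tapes :: "tape list"
  query :: "bool list"
  written :: "io_symbol list"

definition initial :: "machine \<Rightarrow> config" where
  "initial M = \<lparr>state = 0, position = 0, tapes = replicate (num_tapes M) ((\<lambda>_. 0), 0),
     query = [], written = []\<rparr>"

definition step :: "bool list set \<Rightarrow> machine \<Rightarrow> (nat \<Rightarrow> io_symbol) \<Rightarrow> config \<Rightarrow> config" where
  "step A M w C =
     (if state C = ask M
      then C\<lparr>state := if query C \<in> A then yes M else no M, query := []\<rparr>
      else let a = delta M (state C) (w (position C)) (map read_tape (tapes C)) in
        \<lparr>state = goto a,
         position = position C + (if advance a then 1 else 0),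
         tapes = map (\<lambda>(T, b, m). update_tape T b m) (zip (tapes C) (zip (writes a) (moves a))),
         query = query C @ (case enter a of None \<Rightarrow> [] | Some b \<Rightarrow> [b]),
         written = written C @ (case emit a of None \<Rightarrow> [] | Some c \<Rightarrow> [c])\<rparr>)"

definition run :: "bool list set \<Rightarrow> machine \<Rightarrow> (nat \<Rightarrow> io_symbol) \<Rightarrow> nat \<Rightarrow> config" where
  "run A M w t = (step A M w ^^ t) (initial M)"


section \<open>Relative computability\<close>

text \<open>
  A rational is written in lowest terms with positive denominator, both parts in unary.  Unary
  and binary notation can be translated into each other by a machine, so the choice does not
  affect computability.
\<close>

definition rat_code :: "rat \<Rightarrow> io_symbol list" where
  "rat_code r =
     (case quotient_of r of (a, b) \<Rightarrow>
        (if a < 0 then [Minus] else []) @ replicate (nat \<bar>a\<bar>) Stroke @ [Slash] @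
        replicate (nat b) Stroke @ [End])"

text \<open>A finite index type carries no order, so an arbitrary enumeration of the coordinates is fixed.\<close>

definition coords :: "'n::finite list" where
  "coords = (SOME cs. distinct cs \<and> set cs = UNIV)"

definition vec_code :: "rat ^ 'n \<Rightarrow> io_symbol list" where
  "vec_code v = concat (map (\<lambda>i. rat_code (v $ i)) coords)"

text \<open>The infinite concatenation of a sequence of nonempty words.\<close>

definition infinite_concat :: "(nat \<Rightarrow> 'a list) \<Rightarrow> nat \<Rightarrow> 'a" where
  "infinite_concat ws k = concat (map ws [0..<Suc k]) ! k"

text \<open>
  The output tape only ever grows, so the condition says that the infinite word written on it is
  the concatenation of the codes of \<open>p 0\<close>, \<open>p 1\<close>, and so on.
\<close>

definition outputs ::
  "bool list set \<Rightarrow> machine \<Rightarrow> (nat \<Rightarrow> io_symbol) \<Rightarrow> (nat \<Rightarrow> rat) \<Rightarrow> bool" where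
  "outputs A M w p \<longleftrightarrow>
     (\<forall>m. \<exists>t. prefix (concat (map (\<lambda>i. rat_code (p i)) [0..<m])) (written (run A M w t)))"

definition names_vec :: "(nat \<Rightarrow> rat ^ 'n) \<Rightarrow> real ^ 'n \<Rightarrow> bool" where
  "names_vec q x \<longleftrightarrow> (\<forall>n. infnorm (x - (\<chi> i. of_rat (q n $ i))) \<le> 1 / 2 ^ n)"

definition names_real :: "(nat \<Rightarrow> rat) \<Rightarrow> real \<Rightarrow> bool" where
  "names_real p y \<longleftrightarrow> (\<forall>m. \<bar>y - of_rat (p m)\<bar> \<le> 1 / 2 ^ m)"

definition computable_relative_to :: "bool list set \<Rightarrow> ((real ^ 'n) \<times> real) set \<Rightarrow> bool" where
  "computable_relative_to A f \<longleftrightarrow>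
     (\<exists>M. turing_machine M \<and>
       (\<forall>x\<in>Domain f. \<forall>q. names_vec q x \<longrightarrow>
         (\<exists>p. outputs A M (infinite_concat (\<lambda>n. vec_code (q n))) p \<and>
              (\<exists>y\<in>f `` {x}. names_real p y))))"

definition relatively_computable :: "((real ^ 'n) \<times> real) set \<Rightarrow> bool" where
  "relatively_computable f \<longleftrightarrow> (\<exists>A. computable_relative_to A f)"

end

theory Submission
  imports Defs "HOL-Library.Diagonal_Subsequence"
begin

text \<open>
  (a) Given a machine for \<open>f\<close>, first round the given rationals to dyadic ones of prescribed
  precision.  The rounded names of points of a compact set form a compact space, and the machine maps
  names continuously to values.  Hence the values obtained from rounded names form a tightening with
  compact images, and it is computed by the machine preceded by a transducer that rounds.

  (b) By the same compactness the machine has a uniform modulus on dyadic names: the first \<open>N l\<close>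
  entries of a name determine the value up to \<open>2\<^sup>-\<^sup>l\<close>.  A player who keeps these entries of the
  current name as long as the opponent moves by less than \<open>2\<close> to the power \<open>- N l - l - 1\<close>
  wins the game.

  (c) An oracle can encode any function on names for which finitely many entries determine each output.
  Play the strategy against points \<open>x\<^sub>l\<close> of \<open>K\<close> near the \<open>l\<close>-th approximation of \<open>x\<close>.  The
  answers \<open>y\<^sub>l\<close> converge, and since the opponent could play \<open>x\<close> itself after \<open>x\<^sub>l\<close>, the set \<open>f x\<close> has points
  within \<open>2\<^sup>-\<^sup>l\<close> of \<open>y\<^sub>l\<close>.  As \<open>f x\<close> is closed, it contains the limit.
\<close>

section \<open>Words and codes\<close>

text \<open>A rational approximation may have a code of any length, so the names of even a single
  point form no compact set, and there is no bound on how much of them a machine reads. On a fixed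
  grid each entry of a name of a point in a bounded set has only finitely many values; this is where
  compactness comes from. In (a) the oracle is prescribed, so rounding has to be carried out by an
  actual machine, which is the purpose of the transducer and of its composition with
  \<open>M\<close>. In (c) the oracle is free, and one fixed lookup machine serves for all
  functions.

  The value of a machine depends on the name and not only on the point. Limits stay inside the
  values of \<open>f\<close> because the machine must also be correct on the limit name, where
  continuity forces its value. For the same reason the strategy in (b) cannot choose an unrelated
  name at each move: it uses the history to retain entries, and each retention spends part of the
  error allowance.\<close>

lemma prefix_concat_upt:
  "m \<le> n \<Longrightarrow> prefix (concat (map ws [0..<m])) (concat (map ws [0..<n]))"
  by (metis concat_append le0 le_iff_add map_append prefixI upt_add_eq_append)

lemma length_concat_upt_ge:
  assumes "\<And>i. ws i \<noteq> []"
  shows "n \<le> length (concat (map ws [0..<n]))"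
proof (induction n)
  case (Suc n)
  have "length (ws n) > 0" using assms by simp
  with Suc have "Suc n \<le> length (concat (map ws [0..<n])) + length (ws n)" by linarith
  then show ?case by simp
qed simp

lemma prefix_nth: "prefix xs ys \<Longrightarrow> k < length xs \<Longrightarrow> ys ! k = xs ! k"
  by (auto simp: prefix_def nth_append)

lemma infinite_concat_nth:
  assumes "\<And>i. ws i \<noteq> []" and "k < length (concat (map ws [0..<n]))"
  shows "infinite_concat ws k = concat (map ws [0..<n]) ! k"
proof -
  have k: "k < length (concat (map ws [0..<Suc k]))"
    using length_concat_upt_ge[of ws "Suc k", OF assms(1)] by linarith
  show ?thesis
  proof (cases "n \<le> Suc k")
    case True
    then show ?thesis
      unfolding infinite_concat_def using prefix_concat_upt[OF True, of ws] assms(2) prefix_nth by metis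
  next
    case False
    then have "Suc k \<le> n" by simp
    from prefix_concat_upt[OF this, of ws] show ?thesis
      unfolding infinite_concat_def using k prefix_nth by metis
  qed
qed

lemma map_infinite_concat:
  assumes "\<And>i. ws i \<noteq> []"
  shows "map (infinite_concat ws) [0..<length (concat (map ws [0..<n]))] = concat (map ws [0..<n])"
  by (rule nth_equalityI) (auto simp: infinite_concat_nth[OF assms])

lemma infinite_concat_unique:
  assumes ne: "\<And>i. ws i \<noteq> []"
    and w: "\<And>n. map w [0..<length (concat (map ws [0..<n]))] = concat (map ws [0..<n])"
  shows "infinite_concat ws = w"
proof
  fix k
  have k: "k < length (concat (map ws [0..<Suc k]))"
    using length_concat_upt_ge[of ws "Suc k", OF ne] by linarith
  have "concat (map ws [0..<Suc k]) ! k = map w [0..<length (concat (map ws [0..<Suc k]))] ! k"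
    using w[of "Suc k"] by simp
  also have "\<dots> = w k" using k by simp
  finally show "infinite_concat ws k = w k" unfolding infinite_concat_def .
qed

lemma prefix_map_upt_iff:
  "prefix xs (map w [0..<n]) \<longleftrightarrow> length xs \<le> n \<and> xs = map w [0..<length xs]"
proof
  assume p: "prefix xs (map w [0..<n])"
  then have l: "length xs \<le> n" using prefix_length_le by fastforce
  moreover have "xs = map w [0..<length xs]"
    using p l by (intro nth_equalityI) (auto dest!: prefix_nth)
  ultimately show "length xs \<le> n \<and> xs = map w [0..<length xs]" by simp
next
  assume a: "length xs \<le> n \<and> xs = map w [0..<length xs]"
  then have "map w [0..<n] = xs @ map w [length xs..<n]"
    by (metis le0 le_add_diff_inverse map_append upt_add_eq_append)
  then show "prefix xs (map w [0..<n])" by (simp add: prefixI)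
qed

text \<open>Allowing arbitrary continuations combines injectivity with the absence of proper
  prefixes, so that a code can be split off without knowing where it ends.\<close>

definition prefix_free :: "('a \<Rightarrow> 'b list) \<Rightarrow> bool" where
  "prefix_free c \<longleftrightarrow> (\<forall>r s xs ys. c r @ xs = c s @ ys \<longrightarrow> r = s)"

lemma prefix_free_concat:
  assumes "prefix_free c" "concat (map c rs) @ xs = concat (map c ss) @ ys" "length rs = length ss"
  shows "rs = ss"
  using assms(3,2)
proof (induction rs ss rule: list_induct2)
  case (Cons r rs s ss)
  have eq: "c r @ concat (map c rs) @ xs = c s @ concat (map c ss) @ ys"
    using Cons.prems by simp
  then have "r = s" using assms(1) unfolding prefix_free_def by blast
  with eq Cons.IH show ?case by simp
qed simp

lemma append_Cons_unique:
  assumes "xs @ c # us = ys @ c # vs" "c \<notin> set xs" "c \<notin> set ys"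
  shows "xs = ys \<and> us = vs"
  using assms
proof (induction xs arbitrary: ys)
  case Nil then show ?case by (cases ys) auto
next
  case (Cons x xs) then show ?case by (cases ys) auto
qed

lemma rat_code_End: "\<exists>zs. rat_code r = zs @ [End] \<and> End \<notin> set zs"
  unfolding rat_code_def by (auto split: prod.splits)

lemma rat_code_nonempty [simp]: "rat_code r \<noteq> []"
  using rat_code_End[of r] by auto

lemma inj_rat_code: "inj rat_code"
proof (rule injI)
  fix r s assume eq: "rat_code r = rat_code s"
  obtain a b where r: "quotient_of r = (a, b)" by force
  obtain a' b' where s: "quotient_of s = (a', b')" by force
  have pos: "b > 0" "b' > 0" using r s quotient_of_denom_pos by auto
  let ?num = "\<lambda>a::int. (if a < 0 then [Minus] else []) @ replicate (nat \<bar>a\<bar>) Stroke"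
  have code: "rat_code r = ?num a @ Slash # (replicate (nat b) Stroke @ [End])"
    "rat_code s = ?num a' @ Slash # (replicate (nat b') Stroke @ [End])"
    unfolding rat_code_def by (simp_all add: r s)
  have num: "?num a = ?num a'" and "replicate (nat b) Stroke @ [End] = replicate (nat b') Stroke @ [End]"
    using append_Cons_unique[OF eq[unfolded code]] by auto
  then have "nat b = nat b'" by (metis append1_eq_conv length_replicate)
  with pos have b: "b = b'" by simp
  have "Minus \<in> set (?num a) \<longleftrightarrow> a < 0" "Minus \<in> set (?num a') \<longleftrightarrow> a' < 0" by auto
  then have sg: "a < 0 \<longleftrightarrow> a' < 0" using num by simp
  from num sg have "replicate (nat \<bar>a\<bar>) Stroke = replicate (nat \<bar>a'\<bar>) Stroke"
    by (auto split: if_splits)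
  then have "nat \<bar>a\<bar> = nat \<bar>a'\<bar>" by (metis length_replicate)
  with sg have "a = a'" by (auto split: if_splits)
  with b r s show "r = s" by (metis quotient_of_inject)
qed

lemma prefix_free_rat_code: "prefix_free rat_code"
  unfolding prefix_free_def
proof (intro allI impI)
  fix r s xs ys assume eq: "rat_code r @ xs = rat_code s @ ys"
  obtain us vs where "rat_code r = us @ [End]" "End \<notin> set us" "rat_code s = vs @ [End]" "End \<notin> set vs"
    using rat_code_End by meson
  with eq have "rat_code r = rat_code s" using append_Cons_unique[of us End xs vs ys] by simp
  then show "r = s" using inj_rat_code by (simp add: injD)
qed

lemma distinct_coords: "distinct (coords :: 'n::finite list)"
  and set_coords: "set (coords :: 'n::finite list) = UNIV"
proof -
  have "\<exists>cs :: 'n list. distinct cs \<and> set cs = UNIV"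
    using finite_distinct_list[of "UNIV :: 'n set"] by auto
  from someI_ex[OF this] show "distinct (coords :: 'n list)" "set (coords :: 'n list) = UNIV"
    unfolding coords_def by auto
qed

lemma length_coords: "length (coords :: 'n::finite list) = CARD('n)"
  using distinct_card[OF distinct_coords] set_coords by metis

lemma vec_code_nonempty [simp]: "vec_code (v :: rat ^ 'n) \<noteq> []"
proof -
  have "coords \<noteq> ([] :: 'n list)" using set_coords by (metis UNIV_not_empty empty_set)
  then show ?thesis unfolding vec_code_def by (cases "coords :: 'n list") auto
qed

lemma prefix_free_vec_code: "prefix_free (vec_code :: rat ^ 'n \<Rightarrow> _)"
  unfolding prefix_free_def
proof (intro allI impI)
  fix u v :: "rat ^ 'n" and xs ys
  assume "vec_code u @ xs = vec_code v @ ys"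
  then have "map (\<lambda>i. u $ i) coords = map (\<lambda>i. v $ i) coords"
    using prefix_free_concat[OF prefix_free_rat_code, of "map (\<lambda>i. u $ i) coords" xs "map (\<lambda>i. v $ i) coords" ys]
    unfolding vec_code_def by (simp add: comp_def)
  then have "\<forall>i. u $ i = v $ i" using set_coords by auto
  then show "u = v" by (simp add: vec_eq_iff)
qed

text \<open>Unique readability for growing words: what has been read or written so far fixes every
  entry whose code is complete. It serves for input names and for outputs alike.\<close>

lemma prefix_free_upt:
  assumes c: "prefix_free c" and i: "i < m"
    and "prefix (concat (map (\<lambda>i. c (p i)) [0..<m])) zs" "prefix (concat (map (\<lambda>i. c (p' i)) [0..<m])) zs"
  shows "p i = p' i"
proof -
  obtain xs ys where "concat (map c (map p [0..<m])) @ xs = concat (map c (map p' [0..<m])) @ ys"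
    using assms(3,4) unfolding prefix_def by (auto simp: comp_def)
  from prefix_free_concat[OF c this] have "map p [0..<m] = map p' [0..<m]" by simp
  with i show ?thesis by simp
qed

section \<open>Dependence of a run on its input\<close>

abbreviation name_code :: "(nat \<Rightarrow> rat ^ 'n) \<Rightarrow> nat \<Rightarrow> io_symbol" where
  "name_code q \<equiv> infinite_concat (\<lambda>n. vec_code (q n))"

lemma run_Suc: "run A M w (Suc t) = step A M w (run A M w t)"
  by (simp add: run_def)

lemma position_run: "position (run A M w t) \<le> t"
proof (induction t)
  case 0 show ?case by (simp add: run_def initial_def)
next
  case (Suc t)
  have "position (step A M w C) \<le> Suc (position C)" for C
    by (simp add: step_def Let_def)
  from this[of "run A M w t"] Suc show ?case by (simp add: run_Suc)
qed

text \<open>The input head moves by at most one cell in a step, so \<open>t\<close> steps scan only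
  cells before \<open>t\<close>.\<close>

lemma run_cong:
  assumes "\<And>i. i < t \<Longrightarrow> w i = w' i"
  shows "run A M w t = run A M w' t"
  using assms
proof (induction t)
  case 0 show ?case by (simp add: run_def)
next
  case (Suc t)
  then have "run A M w t = run A M w' t" by simp
  moreover have "w (position (run A M w t)) = w' (position (run A M w t))"
    using Suc.prems position_run[of A M w t] by simp
  ultimately show ?case by (simp add: run_Suc step_def)
qed

lemma prefix_written_run:
  assumes "t \<le> t'"
  shows "prefix (written (run A M w t)) (written (run A M w t'))"
  using assms
proof (induction t' rule: dec_induct)
  case (step n)
  have "prefix (written C) (written (step A M w C))" for C
    by (simp add: step_def Let_def)
  with step.IH show ?case unfolding run_Suc using prefix_order.trans by blast
qed simp

section \<open>Machines for functions that are continuous on words\<close>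

abbreviation cell :: "nat \<Rightarrow> tape" where
  "cell a \<equiv> ((\<lambda>_. 0)(0 := a), 0)"

lemma read_cell [simp]: "read_tape (cell a) = a"
  by (simp add: read_tape_def)

lemma update_cell [simp]: "update_tape (cell a) b Stay = cell b"
  by (simp add: update_tape_def)

fun symbol_index :: "io_symbol \<Rightarrow> nat" where
  "symbol_index Stroke = 0" | "symbol_index Minus = 1" | "symbol_index Slash = 2" | "symbol_index End = 3"

fun nth_symbol :: "nat \<Rightarrow> io_symbol" where
  "nth_symbol k = (if k = 0 then Stroke else if k = 1 then Minus else if k = 2 then Slash else End)"

lemma nth_symbol_index [simp]: "nth_symbol (symbol_index c) = c"
  by (cases c) auto

declare nth_symbol.simps [simp del]

lemma symbol_index_less: "symbol_index c < 4"
  by (cases c) auto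

text \<open>
  In each round the machine copies one more input symbol to its work tape, walks over the tape to
  the left and back to the right, and asks a single query.  A symbol needs two bits, of which one
  is entered on the way to the left and the other on the way back.  A positive answer makes it emit
  the symbol whose index is the number of the round modulo 4, which is kept on the second tape.
\<close>

definition oracle_bit :: "nat \<Rightarrow> nat \<Rightarrow> bool" where
  "oracle_bit s r = (if s = 1 then r = 3 \<or> r = 4 else r = 2 \<or> r = 4)"

definition lookup_delta :: "nat \<Rightarrow> io_symbol \<Rightarrow> nat list \<Rightarrow> action" where
  "lookup_delta s c rs = (let a = rs ! 0; j = rs ! 1 in
     if s = 0 then \<lparr>goto = 1, writes = [Suc (symbol_index c), j], moves = [Stay, Stay],
       advance = True, emit = None, enter = None\<rparr>
     else if s = 1 then
       (if a = 0 then \<lparr>goto = 2, writes = [0, j], moves = [Right, Stay],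
          advance = False, emit = None, enter = None\<rparr>
        else \<lparr>goto = 1, writes = [a, j], moves = [Left, Stay],
          advance = False, emit = None, enter = Some (oracle_bit 1 a)\<rparr>)
     else if s = 2 then
       (if a = 0 then \<lparr>goto = 3, writes = [0, j], moves = [Stay, Stay],
          advance = False, emit = None, enter = None\<rparr>
        else \<lparr>goto = 2, writes = [a, j], moves = [Right, Stay],
          advance = False, emit = None, enter = Some (oracle_bit 2 a)\<rparr>)
     else \<lparr>goto = 0, writes = [a, Suc j mod 4], moves = [Stay, Stay],
       advance = False, emit = (if s = 4 then Some (nth_symbol j) else None), enter = None\<rparr>)"

definition lookup_machine :: machine where
  "lookup_machine = \<lparr>num_states = 6, num_symbols = 5, num_tapes = 2, ask = 3, yes = 4, no = 5,
     delta = lookup_delta\<rparr>"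

lemma turing_machine_lookup: "turing_machine lookup_machine"
proof -
  have "goto (lookup_delta s c rs) < 6 \<and> length (writes (lookup_delta s c rs)) = 2 \<and>
      set (writes (lookup_delta s c rs)) \<subseteq> {..<5} \<and> length (moves (lookup_delta s c rs)) = 2"
    if l: "length rs = 2" and rs: "set rs \<subseteq> {..<5}" for s c rs
  proof -
    from l obtain a j where [simp]: "rs = [a, j]" by (auto simp: numeral_2_eq_2 length_Suc_conv)
    from rs have "a < 5" "j < 5" by auto
    moreover have "Suc j mod 4 < 5" using mod_less_divisor[of 4 "Suc j"] by linarith
    ultimately show ?thesis
      using symbol_index_less[of c] by (simp add: lookup_delta_def Let_def)
  qed
  then show ?thesis unfolding turing_machine_def lookup_machine_def by simp
qed

text \<open>Symbols are stored one higher than their index so that the blank delimits the word; both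
  passes recognize their end by it.\<close>

definition word_tape :: "io_symbol list \<Rightarrow> int \<Rightarrow> nat" where
  "word_tape u z = (if 0 \<le> z \<and> z < int (length u) then Suc (symbol_index (u ! nat z)) else 0)"

lemma word_tape_snoc: "(word_tape u)(int (length u) := Suc (symbol_index c)) = word_tape (u @ [c])"
  by (auto simp: word_tape_def fun_eq_iff nth_append nat_eq_iff)

definition symbol_bit :: "nat \<Rightarrow> io_symbol \<Rightarrow> bool" where
  "symbol_bit s c = oracle_bit s (Suc (symbol_index c))"

text \<open>The first half is reversed because the pass to the left meets the last symbol
  first.\<close>

definition query_word :: "io_symbol list \<Rightarrow> bool list" where
  "query_word u = map (symbol_bit 1) (rev u) @ map (symbol_bit 2) u"

text \<open>Two halves of equal length carry the two bits of each symbol, so nothing is lost.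
  Injectivity is what allows an oracle to answer any predicate on finite input words.\<close>

lemma inj_query_word: "inj query_word"
proof (rule injI)
  fix u v assume eq: "query_word u = query_word v"
  then have "length u + length u = length v + length v"
    unfolding query_word_def by (metis length_append length_map length_rev)
  then have l: "length u = length v" by simp
  have "map (symbol_bit 1) (rev u) = map (symbol_bit 1) (rev v)" "map (symbol_bit 2) u = map (symbol_bit 2) v"
    using eq l unfolding query_word_def by simp_all
  then have "map (symbol_bit 1) u = map (symbol_bit 1) v" "map (symbol_bit 2) u = map (symbol_bit 2) v"
    by (simp_all add: rev_map [symmetric])
  then have "symbol_bit 1 (u ! i) = symbol_bit 1 (v ! i) \<and> symbol_bit 2 (u ! i) = symbol_bit 2 (v ! i)"
    if "i < length u" for i
    using that l by (metis nth_map)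
  moreover have "c = d" if "symbol_bit 1 c = symbol_bit 1 d" "symbol_bit 2 c = symbol_bit 2 d" for c d
    using that by (cases c; cases d) (auto simp: symbol_bit_def oracle_bit_def)
  ultimately show "u = v" using l by (auto intro: nth_equalityI)
qed

text \<open>The argument is the input read so far, in reverse order.\<close>

primrec lookup_output :: "(io_symbol list \<Rightarrow> bool) \<Rightarrow> io_symbol list \<Rightarrow> io_symbol list" where
  "lookup_output E [] = []"
| "lookup_output E (c # r) =
     lookup_output E r @ (if E (c # r) then [nth_symbol (length r mod 4)] else [])"

definition round_config :: "nat \<Rightarrow> nat \<Rightarrow> io_symbol list \<Rightarrow> int \<Rightarrow> nat \<Rightarrow> bool list \<Rightarrow> io_symbol list \<Rightarrow> config" where
  "round_config s p u z j qs out =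
     \<lparr>state = s, position = p, tapes = [(word_tape u, z), cell j], query = qs, written = out\<rparr>"

context
  fixes A :: "bool list set" and w :: "nat \<Rightarrow> io_symbol"
begin

abbreviation lookup_step :: "config \<Rightarrow> config" where
  "lookup_step \<equiv> step A lookup_machine w"

lemma lookup_left_pass:
  "k \<le> length u \<Longrightarrow> (lookup_step ^^ k) (round_config 1 p u (int k - 1) j qs out) =
     round_config 1 p u (- 1) j (qs @ map (symbol_bit 1) (rev (take k u))) out"
proof (induction k arbitrary: qs)
  case (Suc k)
  have wt: "word_tape u (int k) = Suc (symbol_index (u ! k))"
    using Suc.prems by (simp add: word_tape_def)
  have "lookup_step (round_config 1 p u (int (Suc k) - 1) j qs out) =
      round_config 1 p u (int k - 1) j (qs @ [symbol_bit 1 (u ! k)]) out"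
    using wt fun_upd_idem[of "word_tape u" "int k", OF wt]
    by (simp add: step_def lookup_machine_def lookup_delta_def round_config_def
        read_tape_def update_tape_def symbol_bit_def)
  then show ?case
    using Suc by (simp add: funpow_Suc_right take_Suc_conv_app_nth del: funpow.simps)
qed simp

lemma lookup_right_pass:
  "k \<le> length u \<Longrightarrow> (lookup_step ^^ k) (round_config 2 p u 0 j qs out) =
     round_config 2 p u (int k) j (qs @ map (symbol_bit 2) (take k u)) out"
proof (induction k)
  case (Suc k)
  have wt: "word_tape u (int k) = Suc (symbol_index (u ! k))"
    using Suc.prems by (simp add: word_tape_def)
  have "lookup_step (round_config 2 p u (int k) j qs' out) =
      round_config 2 p u (int (Suc k)) j (qs' @ [symbol_bit 2 (u ! k)]) out" for qs'
    using wt fun_upd_idem[of "word_tape u" "int k", OF wt]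
    by (simp add: step_def lookup_machine_def lookup_delta_def round_config_def
        read_tape_def update_tape_def symbol_bit_def)
  then show ?case
    using Suc by (simp add: take_Suc_conv_app_nth)
qed simp

lemma lookup_round:
  assumes k: "length u = k" and A: "query_word (u @ [w k]) \<in> A \<longleftrightarrow> b"
  shows "\<exists>t. (lookup_step ^^ t) (round_config 0 k u (int k) j [] out) =
     round_config 0 (Suc k) (u @ [w k]) (int (Suc k)) (Suc j mod 4) []
       (out @ (if b then [nth_symbol j] else []))"
proof -
  let ?u = "u @ [w k]"
  let ?q = "map (symbol_bit 1) (rev ?u)"
  have 1: "(lookup_step ^^ 1) (round_config 0 k u (int k) j [] out) =
      round_config 1 (Suc k) ?u (int (Suc k) - 1) j [] out"
    using k word_tape_snoc[of u "w k"]
    by (simp add: step_def lookup_machine_def lookup_delta_def round_config_def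
        read_tape_def update_tape_def)
  have 2: "(lookup_step ^^ Suc k) (round_config 1 (Suc k) ?u (int (Suc k) - 1) j [] out) =
      round_config 1 (Suc k) ?u (- 1) j ?q out"
    using lookup_left_pass[of "Suc k" ?u "Suc k" j "[]" out] k by simp
  have 3: "(lookup_step ^^ 1) (round_config 1 (Suc k) ?u (- 1) j ?q out) =
      round_config 2 (Suc k) ?u 0 j ?q out"
  proof -
    have [simp]: "word_tape ?u (- 1) = 0" by (simp add: word_tape_def)
    have [simp]: "(word_tape ?u)(- 1 := 0) = word_tape ?u" by (auto simp: word_tape_def)
    show ?thesis
      by (simp add: step_def lookup_machine_def lookup_delta_def round_config_def
        read_tape_def update_tape_def)
  qed
  have 4: "(lookup_step ^^ Suc k) (round_config 2 (Suc k) ?u 0 j ?q out) =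
      round_config 2 (Suc k) ?u (int (Suc k)) j (query_word ?u) out"
    using lookup_right_pass[of "Suc k" ?u "Suc k" j ?q out] k by (simp add: query_word_def)
  have 5: "(lookup_step ^^ 1) (round_config 2 (Suc k) ?u (int (Suc k)) j (query_word ?u) out) =
      round_config 3 (Suc k) ?u (int (Suc k)) j (query_word ?u) out"
  proof -
    have [simp]: "word_tape ?u (1 + int k) = 0" using k by (simp add: word_tape_def)
    have [simp]: "(word_tape ?u)(1 + int k := 0) = word_tape ?u" using k by (auto simp: word_tape_def)
    show ?thesis
      by (simp add: step_def lookup_machine_def lookup_delta_def round_config_def
        read_tape_def update_tape_def)
  qed
  have 6: "(lookup_step ^^ 2) (round_config 3 (Suc k) ?u (int (Suc k)) j (query_word ?u) out) =
      round_config 0 (Suc k) ?u (int (Suc k)) (Suc j mod 4) [] (out @ (if b then [nth_symbol j] else []))"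
    using A
    by (simp add: numeral_2_eq_2 step_def lookup_machine_def lookup_delta_def round_config_def
        read_tape_def update_tape_def)
  have "(lookup_step ^^ (2 + (1 + (Suc k + (1 + (Suc k + 1)))))) (round_config 0 k u (int k) j [] out) =
     round_config 0 (Suc k) ?u (int (Suc k)) (Suc j mod 4) [] (out @ (if b then [nth_symbol j] else []))"
    unfolding funpow_add comp_def 1 2 3 4 5 6 ..
  then show ?thesis by blast
qed

end

lemma lookup_run:
  fixes E :: "io_symbol list \<Rightarrow> bool"
  defines "A \<equiv> {query_word (rev r) |r. E r}"
  shows "\<exists>t. run A lookup_machine w t =
     round_config 0 k (map w [0..<k]) (int k) (k mod 4) [] (lookup_output E (rev (map w [0..<k])))"
proof (induction k)
  case 0
  have "run A lookup_machine w 0 = round_config 0 0 [] 0 0 [] []"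
    by (auto simp: run_def initial_def round_config_def lookup_machine_def word_tape_def numeral_2_eq_2 fun_eq_iff)
  then show ?case by auto
next
  case (Suc k)
  let ?u = "map w [0..<k]"
  have "query_word (?u @ [w k]) \<in> A \<longleftrightarrow> E (w k # rev ?u)"
  proof
    assume "query_word (?u @ [w k]) \<in> A"
    then obtain r where r: "E r" "?u @ [w k] = rev r"
      unfolding A_def using inj_query_word by (auto dest: injD)
    then have "r = rev (?u @ [w k])" by (metis rev_rev_ident)
    with r(1) show "E (w k # rev ?u)" by simp
  next
    assume "E (w k # rev ?u)"
    moreover have "query_word (?u @ [w k]) = query_word (rev (w k # rev ?u))" by simp
    ultimately show "query_word (?u @ [w k]) \<in> A" unfolding A_def by blast
  qed
  from lookup_round[of ?u k w A, OF _ this] obtain t where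
    t: "(step A lookup_machine w ^^ t) (round_config 0 k ?u (int k) (k mod 4) [] (lookup_output E (rev ?u))) =
      round_config 0 (Suc k) (?u @ [w k]) (int (Suc k)) (Suc (k mod 4) mod 4) []
       (lookup_output E (rev ?u) @ (if E (w k # rev ?u) then [nth_symbol (k mod 4)] else []))"
    by (metis (no_types, lifting) diff_zero length_map length_upt)
  from Suc obtain t' where
    "run A lookup_machine w t' = round_config 0 k ?u (int k) (k mod 4) [] (lookup_output E (rev ?u))" by blast
  with t have "run A lookup_machine w (t + t') =
      round_config 0 (Suc k) (map w [0..<Suc k]) (int (Suc k)) (Suc k mod 4) []
       (lookup_output E (rev (map w [0..<Suc k])))"
    by (simp only: run_def funpow_add comp_apply mod_Suc_eq) (simp add: upt_Suc)
  then show ?case by blast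
qed


section \<open>Outputs guided by an arbitrary condition, and local functions\<close>

primrec guided_output :: "(io_symbol list \<Rightarrow> io_symbol list \<Rightarrow> bool) \<Rightarrow> io_symbol list \<Rightarrow> io_symbol list" where
  "guided_output R [] = []"
| "guided_output R (c # r) =
     (let out = guided_output R r; out' = out @ [nth_symbol (length r mod 4)]
      in if R (c # r) out' then out' else out)"

text \<open>The condition may look at the output so far although the oracle is asked only about the
  input: that output is a function of the input, so it can be recomputed inside the oracle
  predicate.\<close>

lemma guided_run:
  "\<exists>A. \<forall>w k. \<exists>t. written (run A lookup_machine w t) = guided_output R (rev (map w [0..<k]))"
proof -
  define E where
    "E r = (r \<noteq> [] \<and> R r (guided_output R (tl r) @ [nth_symbol (length (tl r) mod 4)]))" for r
  have "lookup_output E r = guided_output R r" for r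
    by (induction r) (simp_all add: E_def Let_def)
  then show ?thesis
    using lookup_run[of E] by (metis (no_types, lifting) config.select_convs(5) round_config_def)
qed

lemma guided_output_Suc:
  "guided_output R (rev (map w [0..<Suc k])) =
     (let out = guided_output R (rev (map w [0..<k])) in
        if R (rev (map w [0..<Suc k])) (out @ [nth_symbol (k mod 4)])
        then out @ [nth_symbol (k mod 4)] else out)"
  by (simp add: Let_def)

lemma guided_output_mono:
  assumes "k \<le> k'"
  shows "length (guided_output R (rev (map w [0..<k]))) \<le> length (guided_output R (rev (map w [0..<k'])))"
  using assms
proof (induction k' rule: dec_induct)
  case (step n)
  then show ?case by (simp add: Let_def)
qed simp

text \<open>A symbol is emitted once the input read so far forces it. Candidates recur with period 4
  while input keeps arriving, so every symbol is eventually offered at a moment when enough entries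
  are known.\<close>

theorem local_function_computable:
  fixes p :: "(nat \<Rightarrow> rat ^ 'n) \<Rightarrow> nat \<Rightarrow> rat" and h :: "nat \<Rightarrow> nat"
  assumes p: "\<And>q q' m. (\<And>i. i < h m \<Longrightarrow> q i = q' i) \<Longrightarrow> p q m = p q' m"
    and h: "mono h"
  shows "\<exists>A M. turing_machine M \<and> (\<forall>q. outputs A M (name_code q) (p q))"
proof -
  let ?in = "\<lambda>q m. concat (map (\<lambda>n. vec_code (q n)) [0..<m])"
  let ?out = "\<lambda>q m. concat (map (\<lambda>i. rat_code (p q i)) [0..<m])"
  \<comment> \<open>Any name \<open>q\<close> may serve as witness: by locality and monotonicity of
    \<open>h\<close>, the entries below \<open>h m\<close> that are spelled out by the input fix the
    first \<open>m\<close> outputs.\<close>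
  define R where "R r out \<longleftrightarrow> (\<exists>q m. prefix (?in q (h m)) (rev r) \<and> prefix out (?out q m))" for r out
  obtain A where A: "\<And>w k. \<exists>t. written (run A lookup_machine w t) = guided_output R (rev (map w [0..<k]))"
    using guided_run by meson
  have "outputs A lookup_machine (name_code q) (p q)" for q
  proof -
    define w where "w = name_code q"
    define W where "W = infinite_concat (\<lambda>i. rat_code (p q i))"
    let ?G = "\<lambda>k. guided_output R (rev (map w [0..<k]))"
    have w: "map w [0..<length (?in q m)] = ?in q m" for m
      unfolding w_def by (rule map_infinite_concat) simp
    have W: "map W [0..<length (?out q m)] = ?out q m" for m
      unfolding W_def by (rule map_infinite_concat) simp
    have sound: "out = map W [0..<length out]" if "R (rev (map w [0..<k])) out" for k out
    proof -
      from that obtain q' m where in': "prefix (?in q' (h m)) (map w [0..<k])" and out: "prefix out (?out q' m)"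
        unfolding R_def by auto
      \<comment> \<open>A word long enough to contain both blocks, so that unique readability can
        compare them.\<close>
      let ?z = "map w [0..<max k (length (?in q (h m)))]"
      have "prefix (?in q (h m)) ?z"
        unfolding prefix_map_upt_iff using w[of "h m"] by simp
      moreover have "prefix (?in q' (h m)) ?z"
        using in' unfolding prefix_map_upt_iff by auto
      ultimately have "q i = q' i" if "i < h m" for i
        using prefix_free_upt[OF prefix_free_vec_code that] by blast
      then have "p q i = p q' i" if "i < m" for i
        using that p monoD[OF h, of i m] by (meson less_imp_le_nat less_le_trans)
      then have "?out q' m = ?out q m" by (intro arg_cong[of _ _ concat] map_cong) auto
      with out W[of m] prefix_map_upt_iff[of out W] show ?thesis by metis
    qed
    have G: "?G k = map W [0..<length (?G k)]" for k
    proof (induction k)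
      case (Suc k)
      show ?case
      proof (cases "R (rev (map w [0..<Suc k])) (?G k @ [nth_symbol (k mod 4)])")
        case True
        then have "?G (Suc k) = ?G k @ [nth_symbol (k mod 4)]" by (simp only: guided_output_Suc Let_def if_True)
        with sound[OF True] show ?thesis by (simp only:)
      next
        case False
        then have "?G (Suc k) = ?G k" by (simp only: guided_output_Suc Let_def if_False)
        with Suc show ?thesis by (simp only:)
      qed
    qed simp
    have progress: "\<exists>k. n \<le> length (?G k)" for n
    proof (induction n)
      case (Suc n)
      then obtain k where k: "n \<le> length (?G k)" by blast
      define s where "s = symbol_index (W n)"
      define l where "l = max k (length (?in q (h (Suc n))))"
      \<comment> \<open>The factor 4 makes \<open>s\<close> the residue and keeps the round number
        at least \<open>l\<close>, when the needed entries have been read.\<close>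
      define k' where "k' = 4 * l + s"
      have k': "k \<le> k'" "length (?in q (h (Suc n))) \<le> k'" and mod: "k' mod 4 = s"
        using symbol_index_less[of "W n"] unfolding k'_def l_def s_def by auto
      show ?case
      proof (cases "Suc n \<le> length (?G k')")
        case False
        with k guided_output_mono[OF k'(1), of R w] have len: "length (?G k') = n" by linarith
        have "?G k' = map W [0..<n]" using G[of k'] unfolding len .
        then have "?G k' @ [nth_symbol (k' mod 4)] = map W [0..<Suc n]"
          unfolding mod s_def by simp
        moreover have "prefix (map W [0..<Suc n]) (?out q (Suc n))"
        proof -
          have "prefix (map W [0..<Suc n]) (map W [0..<length (?out q (Suc n))])"
            unfolding prefix_map_upt_iff
            using length_concat_upt_ge[of "\<lambda>i. rat_code (p q i)" "Suc n"] by simp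
          then show ?thesis unfolding W .
        qed
        moreover have "prefix (?in q (h (Suc n))) (map w [0..<Suc k'])"
          unfolding prefix_map_upt_iff using w[of "h (Suc n)"] k'(2) by simp
        ultimately have "R (rev (map w [0..<Suc k'])) (?G k' @ [nth_symbol (k' mod 4)])"
          unfolding R_def rev_rev_ident by metis
        then have "length (?G (Suc k')) = Suc n"
          using len by (simp only: guided_output_Suc Let_def if_True) simp
        then show ?thesis by (metis order_refl)
      qed blast
    qed simp
    show ?thesis
      unfolding outputs_def
    proof
      fix m
      obtain k where "length (?out q m) \<le> length (?G k)" using progress by blast
      then have "prefix (?out q m) (map W [0..<length (?G k)])"
        unfolding prefix_map_upt_iff W by simp
      then have "prefix (?out q m) (?G k)" unfolding G[of k, symmetric] .
      with A[of w k] show "\<exists>t. prefix (?out q m) (written (run A lookup_machine (name_code q) t))"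
        unfolding w_def by metis
    qed
  qed
  with turing_machine_lookup show ?thesis by blast
qed

section \<open>Rounding to odd multiples of a power of two\<close>

text \<open>
  An odd numerator over a power of two is in lowest terms, so the code of the rounded number can be
  written without computing a greatest common divisor.
\<close>

definition odd_round :: "nat \<Rightarrow> rat \<Rightarrow> rat" where
  "odd_round j r = (case quotient_of r of (a, b) \<Rightarrow>
     Fract ((if a < 0 then - 1 else 1) * (2 * (\<bar>a\<bar> * 2 ^ j div b) + 1)) (2 ^ Suc j))"

lemma rat_code_odd_round:
  assumes r: "quotient_of r = (a, b)"
  shows "rat_code (odd_round j r) = (if a < 0 then [Minus] else []) @
     replicate (2 * (nat \<bar>a\<bar> * 2 ^ j div nat b) + 1) Stroke @ [Slash] @ replicate (2 ^ Suc j) Stroke @ [End]"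
proof -
  define k where "k = \<bar>a\<bar> * 2 ^ j div b"
  have b: "b > 0" using r quotient_of_denom_pos by blast
  then have k: "k \<ge> 0" unfolding k_def by (simp add: pos_imp_zdiv_nonneg_iff)
  have nk: "nat k = nat \<bar>a\<bar> * 2 ^ j div nat b"
    unfolding k_def using b by (simp add: nat_div_distrib nat_mult_distrib nat_power_eq)
  let ?c = "(if a < 0 then - 1 else 1) * (2 * k + 1)"
  have "coprime ?c (2 ^ Suc j)" by (simp add: coprime_commute)
  then have "quotient_of (odd_round j r) = (?c, 2 ^ Suc j)"
    unfolding odd_round_def r prod.case k_def[symmetric] by (simp add: quotient_of_Fract normalize_stable)
  moreover have "?c < 0 \<longleftrightarrow> a < 0" using k by auto
  moreover have "nat \<bar>?c\<bar> = 2 * nat k + 1" using k by auto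
  moreover have "nat (2 ^ Suc j) = 2 ^ Suc j" by (simp add: nat_power_eq nat_mult_distrib)
  ultimately show ?thesis unfolding rat_code_def nk[symmetric] by simp
qed

text \<open>The integer division locates the absolute value of \<open>r\<close> in a cell of length
  \<open>1 / 2 ^ j\<close>. The odd numerator gives the midpoint of that cell, so the error is at
  most half its length.\<close>

lemma odd_round_error: "\<bar>odd_round j r - r\<bar> \<le> 1 / 2 ^ Suc j"
proof -
  obtain a b where r: "quotient_of r = (a, b)" by force
  have b: "b > 0" using r quotient_of_denom_pos by blast
  define k where "k = \<bar>a\<bar> * 2 ^ j div b"
  have "k * b \<le> \<bar>a\<bar> * 2 ^ j" "\<bar>a\<bar> * 2 ^ j < (k + 1) * b"
    using div_mult_mod_eq[of "\<bar>a\<bar> * 2 ^ j" b] pos_mod_sign[OF b, of "\<bar>a\<bar> * 2 ^ j"]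
      pos_mod_bound[OF b, of "\<bar>a\<bar> * 2 ^ j"] unfolding k_def[symmetric] distrib_right by linarith+
  then have "rat_of_int (k * b) \<le> rat_of_int (\<bar>a\<bar> * 2 ^ j)" "rat_of_int (\<bar>a\<bar> * 2 ^ j) \<le> rat_of_int ((k + 1) * b)"
    by linarith+
  moreover have b': "rat_of_int b > 0" using b by simp
  ultimately have lo: "of_int k / 2 ^ j \<le> of_int \<bar>a\<bar> / rat_of_int b"
    and hi: "of_int \<bar>a\<bar> / rat_of_int b \<le> (of_int k + 1) / 2 ^ j"
    by (simp_all add: field_simps)
  have mid: "(2 * of_int k + 1) / 2 ^ Suc j = of_int k / 2 ^ j + 1 / (2 ^ Suc j :: rat)"
    "(of_int k + 1) / 2 ^ j = of_int k / 2 ^ j + 2 * (1 / (2 ^ Suc j :: rat))"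
    by (simp_all add: field_simps)
  have err: "\<bar>(2 * of_int k + 1) / 2 ^ Suc j - of_int \<bar>a\<bar> / rat_of_int b\<bar> \<le> 1 / 2 ^ Suc j"
    using lo hi unfolding mid by (simp only: abs_le_iff) linarith
  have r': "r = of_int a / of_int b" using quotient_of_div[OF r] .
  have o: "odd_round j r = (if a < 0 then - 1 else 1) * ((2 * of_int k + 1) / 2 ^ Suc j)"
    unfolding odd_round_def r prod.case k_def[symmetric] by (simp add: Fract_of_int_quotient)
  show ?thesis
  proof (cases "a < 0")
    case True
    have "odd_round j r - r = - ((2 * of_int k + 1) / 2 ^ Suc j - of_int \<bar>a\<bar> / rat_of_int b)"
    proof -
      have "odd_round j r = - ((2 * of_int k + 1) / 2 ^ Suc j)"
        unfolding o using True by (simp only: if_True mult_minus1)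
      moreover have "r = - (of_int \<bar>a\<bar> / of_int b)" using r' True by simp
      ultimately show ?thesis by linarith
    qed
    with err show ?thesis by (metis abs_minus_cancel)
  next
    case False
    have "odd_round j r = (2 * of_int k + 1) / 2 ^ Suc j" using o False by simp
    moreover have "r = of_int \<bar>a\<bar> / of_int b" using r' False by simp
    ultimately show ?thesis using err by metis
  qed
qed

lemma odd_round_grid: "\<exists>z::int. odd_round j r = of_int z / 2 ^ Suc j"
proof -
  obtain a b where r: "quotient_of r = (a, b)" by force
  show ?thesis
    unfolding odd_round_def r
    by (simp only: prod.case Fract_of_int_quotient) (metis of_int_numeral of_int_power)
qed


section \<open>A transducer that rounds\<close>

text \<open>
  A finite control with four counters, whose values are \<open>p\<close>, \<open>n\<close>, \<open>b\<close> and \<open>q\<close>.  It skips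
  \<open>d\<close> rationals (states from 13 on) and then replaces the \<open>j\<close>-th of the following ones, \<open>a / b\<close>,
  by its image under \<open>odd_round j\<close>.  The counter \<open>p\<close> holds \<open>2 ^ j\<close>.  States 2 to 4 compute
  \<open>n = \<bar>a\<bar> * p\<close>; state 5 reads \<open>b\<close>; states 6 to 8 divide \<open>n\<close> by \<open>b\<close> and emit two strokes for each
  unit of the quotient and one more stroke; states 10 to 12 emit the new denominator and double \<open>p\<close>.
  The components of the result are the next state, whether to advance on the input, the emitted
  symbol, and the moves of the counters.
\<close>

definition rounding_delta ::
  "nat \<Rightarrow> nat \<Rightarrow> io_symbol \<Rightarrow> bool \<Rightarrow> bool \<Rightarrow> bool \<Rightarrow> bool \<Rightarrow>
   nat \<times> bool \<times> io_symbol option \<times> move \<times> move \<times> move \<times> move" where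
  "rounding_delta d s c p0 n0 b0 q0 =
    (if s = 0 then (12 + d, False, None, Right, Stay, Stay, Stay)
     else if s = 1 then
       if c = Minus then (2, True, Some Minus, Stay, Stay, Stay, Stay)
       else (2, False, None, Stay, Stay, Stay, Stay)
     else if s = 2 then
       if c = Stroke then (3, True, None, Stay, Stay, Stay, Stay)
       else (5, True, None, Stay, Stay, Stay, Stay)
     else if s = 3 then
       if p0 then (4, False, None, Stay, Stay, Stay, Stay)
       else (3, False, None, Left, Right, Stay, Right)
     else if s = 4 then
       if q0 then (2, False, None, Stay, Stay, Stay, Stay)
       else (4, False, None, Right, Stay, Stay, Left)
     else if s = 5 then
       if c = Stroke then (5, True, None, Stay, Stay, Right, Stay)
       else (6, True, None, Stay, Stay, Stay, Stay)
     else if s = 6 then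
       if b0 then (7, False, Some Stroke, Stay, Stay, Stay, Stay)
       else if n0 then (8, False, None, Stay, Stay, Stay, Stay)
       else (6, False, None, Stay, Left, Left, Right)
     else if s = 7 then
       if q0 then (6, False, Some Stroke, Stay, Stay, Stay, Stay)
       else (7, False, None, Stay, Stay, Right, Left)
     else if s = 8 then
       if \<not> b0 then (8, False, None, Stay, Stay, Left, Stay)
       else if \<not> q0 then (8, False, None, Stay, Stay, Stay, Left)
       else (9, False, Some Stroke, Stay, Stay, Stay, Stay)
     else if s = 9 then (10, False, Some Slash, Stay, Stay, Stay, Stay)
     else if s = 10 then
       if p0 then (11, False, None, Stay, Stay, Stay, Stay)
       else (10, False, Some Stroke, Left, Right, Stay, Right)
     else if s = 11 then
       if q0 then (12, False, None, Stay, Stay, Stay, Stay)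
       else (11, False, Some Stroke, Right, Stay, Stay, Left)
     else if s = 12 then
       if n0 then (1, False, Some End, Stay, Stay, Stay, Stay)
       else (12, False, None, Right, Left, Stay, Stay)
     else (if c = End then if s = 13 then 1 else s - 1 else s, True, None, Stay, Stay, Stay, Stay))"

definition offset :: "move \<Rightarrow> int" where
  "offset m = (case m of Left \<Rightarrow> - 1 | Stay \<Rightarrow> 0 | Right \<Rightarrow> 1)"

lemma offset_simps [simp]: "offset Left = - 1" "offset Stay = 0" "offset Right = 1"
  by (simp_all add: offset_def)

type_synonym tconfig = "nat \<times> nat \<times> int \<times> int \<times> int \<times> int \<times> io_symbol list"

text \<open>Counters are plain integers here. The arithmetic is verified on this abstract machine;
  tapes enter only with the composition.\<close>

fun rounding_step :: "nat \<Rightarrow> (nat \<Rightarrow> io_symbol) \<Rightarrow> tconfig \<Rightarrow> tconfig" where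
  "rounding_step d w (s, i, p, n, b, q, out) =
     (case rounding_delta d s (w i) (p = 0) (n = 0) (b = 0) (q = 0) of
        (s', adv, em, mp, mn, mb, mq) \<Rightarrow>
          (s', i + (if adv then 1 else 0), p + offset mp, n + offset mn, b + offset mb, q + offset mq,
           out @ (case em of None \<Rightarrow> [] | Some c \<Rightarrow> [c])))"

context
  fixes d :: nat and w :: "nat \<Rightarrow> io_symbol"
begin

definition reach :: "tconfig \<Rightarrow> tconfig \<Rightarrow> bool" where
  "reach x y \<longleftrightarrow> (\<exists>t. (rounding_step d w ^^ t) x = y)"

lemma reach_refl: "reach x x"
  unfolding reach_def by (metis funpow_0)

lemma reach_trans [trans]: "reach x y \<Longrightarrow> reach y z \<Longrightarrow> reach x z"
  unfolding reach_def by (metis comp_apply funpow_add)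

lemma reach_step: "reach (rounding_step d w x) y \<Longrightarrow> reach x y"
  unfolding reach_def by (metis comp_apply funpow_Suc_right)

lemma reach_1: "rounding_step d w x = y \<Longrightarrow> reach x y"
  using reach_step reach_refl by metis

text \<open>Adding \<open>p\<close> to \<open>n\<close> destroys \<open>p\<close>, so a copy is
  built up in \<open>q\<close>, from which state 4 restores it.\<close>

lemma reach_multiply: "reach (3, i, int k, n, b, q, out) (4, i, 0, n + int k, b, q + int k, out)"
proof (induction k arbitrary: n q)
  case 0 show ?case by (rule reach_1) (simp add: rounding_delta_def)
next
  case (Suc k)
  show ?case
    by (rule reach_step) (use Suc[of "n + 1" "q + 1"] in \<open>simp add: rounding_delta_def ac_simps\<close>)
qed

lemma reach_restore_p: "reach (4, i, p, n, b, int k, out) (2, i, p + int k, n, b, 0, out)"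
proof (induction k arbitrary: p)
  case 0 show ?case by (rule reach_1) (simp add: rounding_delta_def)
next
  case (Suc k)
  show ?case
    by (rule reach_step) (use Suc[of "p + 1"] in \<open>simp add: rounding_delta_def ac_simps\<close>)
qed

lemma reach_numerator:
  assumes "\<And>l. l < k \<Longrightarrow> w (i + l) = Stroke" "w (i + k) = Slash"
  shows "reach (2, i, int p, n, b, 0, out) (5, i + k + 1, int p, n + int (k * p), b, 0, out)"
  using assms
proof (induction k arbitrary: i n)
  case 0 then show ?case by (intro reach_1) (simp add: rounding_delta_def)
next
  case (Suc k)
  have w: "w (Suc i + l) = Stroke" if "l < k" for l using Suc.prems(1)[of "Suc l"] that by simp
  have "reach (2, i, int p, n, b, 0, out) (3, i + 1, int p, n, b, 0, out)"
    using Suc.prems(1)[of 0] by (intro reach_1) (simp add: rounding_delta_def)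
  also have "reach \<dots> (4, i + 1, 0, n + int p, b, int p, out)"
    using reach_multiply[of "i + 1" p n b 0 out] by simp
  also have "reach \<dots> (2, i + 1, int p, n + int p, b, 0, out)"
    using reach_restore_p[of "i + 1" 0 "n + int p" b p out] by simp
  also have "reach \<dots> (5, i + Suc k + 1, int p, n + int (Suc k * p), b, 0, out)"
    using Suc.IH[of "Suc i" "n + int p"] w Suc.prems(2) by (simp add: ac_simps)
  finally show ?case .
qed

lemma reach_denominator:
  assumes "\<And>l. l < k \<Longrightarrow> w (i + l) = Stroke" "w (i + k) = End"
  shows "reach (5, i, p, n, b, q, out) (6, i + k + 1, p, n, b + int k, q, out)"
  using assms
proof (induction k arbitrary: i b)
  case 0 then show ?case by (intro reach_1) (simp add: rounding_delta_def)
next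
  case (Suc k)
  have w: "w (Suc i + l) = Stroke" if "l < k" for l using Suc.prems(1)[of "Suc l"] that by simp
  have "reach (5, i, p, n, b, q, out) (5, Suc i, p, n, b + 1, q, out)"
    using Suc.prems(1)[of 0] by (intro reach_1) (simp add: rounding_delta_def)
  also have "reach \<dots> (6, i + Suc k + 1, p, n, b + int (Suc k), q, out)"
    using Suc.IH[of "Suc i" "b + 1"] w Suc.prems(2) by (simp add: ac_simps)
  finally show ?case .
qed

lemma reach_restore_b: "reach (7, i, p, n, b, int k, out) (6, i, p, n, b + int k, 0, out @ [Stroke])"
proof (induction k arbitrary: b)
  case 0 show ?case by (rule reach_1) (simp add: rounding_delta_def)
next
  case (Suc k)
  show ?case
    by (rule reach_step) (use Suc[of "b + 1"] in \<open>simp add: rounding_delta_def ac_simps\<close>)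
qed

text \<open>Here \<open>b'\<close> is what remains of the current divisor and \<open>q\<close> holds
  the part \<open>b - b'\<close> already taken off, so the strokes still to come number twice the
  quotient of \<open>n + (b - b')\<close> by \<open>b\<close>. An exhausted divisor is detected
  before an exhausted \<open>n\<close>, which counts the last unit of an exact division. The
  leftovers \<open>b''\<close> and \<open>q\<close> are arbitrary because state 8 erases
  them.\<close>

lemma reach_divide:
  assumes "0 < b'" "b' \<le> b"
  shows "\<exists>b'' q. reach (6, i, p, int n, int b', int (b - b'), out)
     (8, i, p, 0, int b'', int q, out @ replicate (2 * ((n + (b - b')) div b)) Stroke)"
  using assms
proof (induction n arbitrary: b' out)
  case 0
  then have "reach (6, i, p, int 0, int b', int (b - b'), out)
     (8, i, p, 0, int b', int (b - b'), out @ replicate (2 * ((0 + (b - b')) div b)) Stroke)"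
    by (intro reach_1) (simp add: rounding_delta_def)
  then show ?case by blast
next
  case (Suc n)
  obtain c where c: "b' = Suc c" using Suc.prems(1) gr0_implies_Suc by blast
  have diff: "int (b - c) = int (b - b') + 1" "Suc n + (b - b') = n + (b - c)"
    using Suc.prems c by auto
  have 1: "reach (6, i, p, int (Suc n), int b', int (b - b'), out)
      (6, i, p, int n, int c, int (b - c), out)"
    unfolding diff using c by (intro reach_1) (simp add: rounding_delta_def)
  show ?case
  proof (cases "c = 0")
    case True
    note 1
    also have "reach (6, i, p, int n, int c, int (b - c), out) (7, i, p, int n, 0, int b, out @ [Stroke])"
      using True by (intro reach_1) (simp add: rounding_delta_def)
    also have "reach \<dots> (6, i, p, int n, int b, int (b - b), out @ [Stroke, Stroke])"
      using reach_restore_b[of i p "int n" 0 b "out @ [Stroke]"] by simp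
    finally have 2: "reach (6, i, p, int (Suc n), int b', int (b - b'), out)
      (6, i, p, int n, int b, int (b - b), out @ [Stroke, Stroke])" .
    obtain b'' q where 3: "reach (6, i, p, int n, int b, int (b - b), out @ [Stroke, Stroke])
        (8, i, p, 0, int b'', int q, (out @ [Stroke, Stroke]) @ replicate (2 * ((n + (b - b)) div b)) Stroke)"
      using Suc.IH[of b "out @ [Stroke, Stroke]"] Suc.prems by auto
    have "(out @ [Stroke, Stroke]) @ replicate (2 * ((n + (b - b)) div b)) Stroke =
        out @ replicate (2 * ((Suc n + (b - b')) div b)) Stroke"
      unfolding diff using True Suc.prems by simp
    with reach_trans[OF 2 3] show ?thesis by metis
  next
    case False
    then obtain b'' q where "reach (6, i, p, int n, int c, int (b - c), out)
        (8, i, p, 0, int b'', int q, out @ replicate (2 * ((n + (b - c)) div b)) Stroke)"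
      using Suc.IH[of c out] Suc.prems c by auto
    with reach_trans[OF 1] show ?thesis unfolding diff(2) by blast
  qed
qed

lemma reach_clear: "reach (8, i, p, n, int b, int q, out) (9, i, p, n, 0, 0, out @ [Stroke])"
proof (induction b)
  case 0
  show ?case
  proof (induction q)
    case 0 show ?case by (rule reach_1) (simp add: rounding_delta_def)
  next
    case (Suc q)
    then show ?case by (intro reach_step[of "(8, i, p, n, int 0, int (Suc q), out)"]) (simp add: rounding_delta_def)
  qed
next
  case (Suc b)
  then show ?case by (intro reach_step[of "(8, i, p, n, int (Suc b), int q, out)"]) (simp add: rounding_delta_def)
qed

lemma reach_first_half:
  "reach (10, i, int k, n, b, q, out) (11, i, 0, n + int k, b, q + int k, out @ replicate k Stroke)"
proof (induction k arbitrary: n q out)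
  case 0 show ?case by (rule reach_1) (simp add: rounding_delta_def)
next
  case (Suc k)
  show ?case
    by (rule reach_step)
      (use Suc[of "n + 1" "q + 1" "out @ [Stroke]"] in \<open>simp add: rounding_delta_def ac_simps\<close>)
qed

lemma reach_second_half:
  "reach (11, i, p, n, b, int k, out) (12, i, p + int k, n, b, 0, out @ replicate k Stroke)"
proof (induction k arbitrary: p out)
  case 0 show ?case by (rule reach_1) (simp add: rounding_delta_def)
next
  case (Suc k)
  show ?case
    by (rule reach_step)
      (use Suc[of "p + 1" "out @ [Stroke]"] in \<open>simp add: rounding_delta_def ac_simps\<close>)
qed

lemma reach_double: "reach (12, i, p, int k, b, q, out) (1, i, p + int k, 0, b, q, out @ [End])"
proof (induction k arbitrary: p)
  case 0 show ?case by (rule reach_1) (simp add: rounding_delta_def)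
next
  case (Suc k)
  show ?case
    by (rule reach_step) (use Suc[of "p + 1"] in \<open>simp add: rounding_delta_def ac_simps\<close>)
qed

lemma reach_rational:
  assumes w: "map (\<lambda>l. w (i + l)) [0..<length (rat_code r)] = rat_code r"
  shows "reach (1, i, int (2 ^ j), 0, 0, 0, out)
     (1, i + length (rat_code r), int (2 ^ Suc j), 0, 0, 0, out @ rat_code (odd_round j r))"
proof -
  obtain a b where r: "quotient_of r = (a, b)" by force
  have b: "nat b > 0" using r quotient_of_denom_pos by fastforce
  define sg where "sg = (if a < 0 then [Minus] else [])"
  define i' where "i' = i + length sg"
  have code: "rat_code r = sg @ replicate (nat \<bar>a\<bar>) Stroke @ Slash # replicate (nat b) Stroke @ [End]"
    unfolding rat_code_def r sg_def by simp
  have nth: "w (i + l) = rat_code r ! l" if "l < length (rat_code r)" for l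
    using that by (metis (no_types, lifting) w add.left_neutral diff_zero length_upt nth_map nth_upt)
  have len: "length (rat_code r) = length sg + nat \<bar>a\<bar> + nat b + 2"
    unfolding code by simp
  have num: "w (i' + l) = Stroke" if "l < nat \<bar>a\<bar>" for l
    using nth[of "length sg + l"] that len unfolding i'_def
    by (simp add: code nth_append add.assoc)
  have slash: "w (i' + nat \<bar>a\<bar>) = Slash"
    using nth[of "length sg + nat \<bar>a\<bar>"] len unfolding i'_def
    by (simp add: code nth_append add.assoc)
  define i'' where "i'' = i' + nat \<bar>a\<bar> + 1"
  have den: "w (i'' + l) = Stroke" if "l < nat b" for l
    using nth[of "length sg + nat \<bar>a\<bar> + Suc l"] that len unfolding i''_def i'_def
    by (simp add: code nth_append add.assoc)
  have fin: "w (i'' + nat b) = End"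
    using nth[of "length sg + nat \<bar>a\<bar> + Suc (nat b)"] len unfolding i''_def i'_def
    by (simp add: code nth_append add.assoc)
  let ?P = "int (2 ^ j)" and ?n = "nat \<bar>a\<bar> * 2 ^ j" and ?e = "i'' + nat b + 1"
  have e: "?e = i + length (rat_code r)" unfolding len i''_def i'_def by simp
  have "reach (1, i, ?P, 0, 0, 0, out) (2, i', ?P, 0, 0, 0, out @ sg)"
  proof (cases "a < 0")
    case True
    then have "w i = Minus" using nth[of 0] len by (simp add: code sg_def)
    then show ?thesis using True unfolding i'_def sg_def
      by (intro reach_1) (simp add: rounding_delta_def)
  next
    case False
    then have "w i \<noteq> Minus"
      using num[of 0] slash unfolding i'_def sg_def by (cases "nat \<bar>a\<bar> = 0") auto
    then show ?thesis using False unfolding i'_def sg_def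
      by (intro reach_1) (simp add: rounding_delta_def)
  qed
  also have "reach \<dots> (5, i'', ?P, int ?n, 0, 0, out @ sg)"
    using reach_numerator[of "nat \<bar>a\<bar>" i' "2 ^ j" 0 0 "out @ sg"] num slash unfolding i''_def by simp
  also have "reach \<dots> (6, ?e, ?P, int ?n, int (nat b), 0, out @ sg)"
    using reach_denominator[of "nat b" i'' ?P "int ?n" 0 0 "out @ sg"] den fin by simp
  finally have 1: "reach (1, i, ?P, 0, 0, 0, out) (6, ?e, ?P, int ?n, int (nat b), 0, out @ sg)" .
  let ?out = "out @ sg @ replicate (2 * (?n div nat b)) Stroke"
  obtain b'' q where 2: "reach (6, ?e, ?P, int ?n, int (nat b), 0, out @ sg)
      (8, ?e, ?P, 0, int b'', int q, ?out)"
    using reach_divide[of "nat b" "nat b" ?e ?P ?n "out @ sg"] b by auto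
  have "reach (8, ?e, ?P, 0, int b'', int q, ?out) (9, ?e, ?P, 0, 0, 0, ?out @ [Stroke])"
    by (rule reach_clear)
  also have "reach \<dots> (10, ?e, ?P, 0, 0, 0, ?out @ [Stroke, Slash])"
    by (rule reach_1) (simp add: rounding_delta_def)
  also have "reach \<dots> (11, ?e, 0, ?P, 0, ?P, ?out @ [Stroke, Slash] @ replicate (2 ^ j) Stroke)"
    using reach_first_half[of ?e "2 ^ j" 0 0 0 "?out @ [Stroke, Slash]"] by simp
  also have "reach \<dots> (12, ?e, ?P, ?P, 0, 0,
      ?out @ [Stroke, Slash] @ replicate (2 ^ j) Stroke @ replicate (2 ^ j) Stroke)"
    using reach_second_half[of ?e 0 ?P 0 "2 ^ j" "?out @ [Stroke, Slash] @ replicate (2 ^ j) Stroke"] by simp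
  \<comment> \<open>State 10 has left a copy of the power in \<open>n\<close>; adding it to
    \<open>p\<close> doubles the power for the next rational.\<close>
  also have "reach \<dots> (1, ?e, ?P + ?P, 0, 0, 0,
      ?out @ [Stroke, Slash] @ replicate (2 ^ j) Stroke @ replicate (2 ^ j) Stroke @ [End])"
    using reach_double[of ?e ?P "2 ^ j" 0 0 "?out @ [Stroke, Slash] @ replicate (2 ^ j) Stroke @ replicate (2 ^ j) Stroke"]
    by simp
  finally have 3: "reach (8, ?e, ?P, 0, int b'', int q, ?out) (1, ?e, ?P + ?P, 0, 0, 0,
      ?out @ [Stroke, Slash] @ replicate (2 ^ j) Stroke @ replicate (2 ^ j) Stroke @ [End])" .
  have P: "?P + ?P = int (2 ^ Suc j)" by simp
  have out: "?out @ [Stroke, Slash] @ replicate (2 ^ j) Stroke @ replicate (2 ^ j) Stroke @ [End] =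
      out @ rat_code (odd_round j r)"
    unfolding rat_code_odd_round[OF r] sg_def[symmetric]
    by (simp add: replicate_add[symmetric] replicate_append_same[symmetric] mult_2)
  show ?thesis
    using reach_trans[OF 1 reach_trans[OF 2 3]] unfolding e P out .
qed

lemma reach_skip_1:
  assumes "\<And>l. l < k \<Longrightarrow> w (i + l) \<noteq> End" "w (i + k) = End" "13 \<le> s"
  shows "reach (s, i, p, n, b, q, out) (if s = 13 then 1 else s - 1, i + k + 1, p, n, b, q, out)"
  using assms
proof (induction k arbitrary: i)
  case 0 then show ?case by (intro reach_1) (simp add: rounding_delta_def)
next
  case (Suc k)
  have w: "w (Suc i + l) \<noteq> End" if "l < k" for l using Suc.prems(1)[of "Suc l"] that by simp
  have "reach (s, i, p, n, b, q, out) (s, Suc i, p, n, b, q, out)"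
    using Suc.prems(1)[of 0] Suc.prems(3) by (intro reach_1) (simp add: rounding_delta_def)
  also have "reach \<dots> (if s = 13 then 1 else s - 1, i + Suc k + 1, p, n, b, q, out)"
    using Suc.IH[of "Suc i"] w Suc.prems(2,3) by simp
  finally show ?case .
qed

lemma reach_skip_rational:
  assumes w: "map (\<lambda>l. w (i + l)) [0..<length (rat_code r)] = rat_code r" and s: "13 \<le> s"
  shows "reach (s, i, p, n, b, q, out)
     (if s = 13 then 1 else s - 1, i + length (rat_code r), p, n, b, q, out)"
proof -
  obtain zs where z: "rat_code r = zs @ [End]" "End \<notin> set zs" using rat_code_End by blast
  have nth: "w (i + l) = rat_code r ! l" if "l < length (rat_code r)" for l
    using that by (metis (no_types, lifting) w add.left_neutral diff_zero length_upt nth_map nth_upt)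
  have "w (i + l) \<noteq> End" if "l < length zs" for l
    using nth[of l] that z by (simp add: nth_append) (metis nth_mem)
  moreover have "w (i + length zs) = End" using nth[of "length zs"] z by simp
  ultimately show ?thesis
    using reach_skip_1[of "length zs" i s p n b q out] s z by simp
qed

end

lemma infinite_concat_block:
  assumes "\<And>i. ws i \<noteq> []"
  shows "map (\<lambda>l. infinite_concat ws (length (concat (map ws [0..<m])) + l)) [0..<length (ws m)] = ws m"
proof (rule nth_equalityI)
  fix l assume "l < length (map (\<lambda>l. infinite_concat ws (length (concat (map ws [0..<m])) + l)) [0..<length (ws m)])"
  then show "map (\<lambda>l. infinite_concat ws (length (concat (map ws [0..<m])) + l)) [0..<length (ws m)] ! l = ws m ! l"
    using infinite_concat_nth[of ws "length (concat (map ws [0..<m])) + l" "Suc m", OF assms]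
    by (simp add: nth_append)
qed simp

definition tconfig_output :: "tconfig \<Rightarrow> io_symbol list" where
  "tconfig_output x = (case x of (s, i, p, n, b, q, out) \<Rightarrow> out)"

lemma rounding_outputs:
  fixes r :: "nat \<Rightarrow> rat"
  assumes d: "0 < d"
  shows "\<exists>t. tconfig_output ((rounding_step d (infinite_concat (\<lambda>j. rat_code (r j))) ^^ t) (0, 0, 0, 0, 0, 0, [])) =
    concat (map (\<lambda>j. rat_code (odd_round j (r (d + j)))) [0..<m])"
proof -
  define ws where "ws = (\<lambda>j. rat_code (r j))"
  define w where "w = infinite_concat ws"
  have block: "map (\<lambda>l. w (length (concat (map ws [0..<m])) + l)) [0..<length (rat_code (r m))] = rat_code (r m)" for m
    using infinite_concat_block[of ws m] unfolding w_def ws_def by simp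
  \<comment> \<open>The control state counts the rationals still to be skipped. After 13 it
    continues with 1, since 12 has another use. The first step sets \<open>p\<close> to 1, which is
    \<open>2 ^ 0\<close>.\<close>
  have skip: "reach d w (0, 0, 0, 0, 0, 0, [])
      (if l = d then 1 else 12 + d - l, length (concat (map ws [0..<l])), 1, 0, 0, 0, [])" if "l \<le> d" for l
    using that
  proof (induction l)
    case 0
    then show ?case using d by (intro reach_1) (simp add: rounding_delta_def)
  next
    case (Suc l)
    then have "reach d w (0, 0, 0, 0, 0, 0, []) (12 + d - l, length (concat (map ws [0..<l])), 1, 0, 0, 0, [])"
      by simp
    also have "reach d w \<dots> (if 12 + d - l = 13 then 1 else 12 + d - l - 1,
        length (concat (map ws [0..<l])) + length (rat_code (r l)), 1, 0, 0, 0, [])"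
      using block[of l] Suc.prems by (intro reach_skip_rational) auto
    also have "(if 12 + d - l = 13 then 1 else 12 + d - l - 1,
        length (concat (map ws [0..<l])) + length (rat_code (r l)), 1, 0, 0, 0, []) =
        (if Suc l = d then 1 else 12 + d - Suc l, length (concat (map ws [0..<Suc l])), 1 :: int, 0 :: int, 0 :: int, 0 :: int, [] :: io_symbol list)"
      using Suc.prems unfolding ws_def by auto
    finally show ?case .
  qed
  have "reach d w (0, 0, 0, 0, 0, 0, []) (1, length (concat (map ws [0..<d + m])), int (2 ^ m), 0, 0, 0,
      concat (map (\<lambda>j. rat_code (odd_round j (r (d + j)))) [0..<m]))" for m
  proof (induction m)
    case 0
    show ?case using skip[of d] by simp
  next
    case (Suc m)
    note Suc
    also have "reach d w (1, length (concat (map ws [0..<d + m])), int (2 ^ m), 0, 0, 0,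
        concat (map (\<lambda>j. rat_code (odd_round j (r (d + j)))) [0..<m]))
      (1, length (concat (map ws [0..<d + m])) + length (rat_code (r (d + m))), int (2 ^ Suc m), 0, 0, 0,
        concat (map (\<lambda>j. rat_code (odd_round j (r (d + j)))) [0..<m]) @ rat_code (odd_round m (r (d + m))))"
      by (rule reach_rational[OF block])
    finally show ?case unfolding ws_def by simp
  qed
  from this[of m] obtain t where "(rounding_step d w ^^ t) (0, 0, 0, 0, 0, 0, []) =
      (1, length (concat (map ws [0..<d + m])), int (2 ^ m), 0, 0, 0,
      concat (map (\<lambda>j. rat_code (odd_round j (r (d + j)))) [0..<m]))"
    unfolding reach_def by blast
  then have "tconfig_output ((rounding_step d w ^^ t) (0, 0, 0, 0, 0, 0, [])) =
      concat (map (\<lambda>j. rat_code (odd_round j (r (d + j)))) [0..<m])"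
    by (simp only: tconfig_output_def case_prod_conv)
  then show ?thesis unfolding w_def ws_def by blast
qed

section \<open>Names of vectors as streams of rationals\<close>

definition flatten :: "(nat \<Rightarrow> 'a ^ 'n) \<Rightarrow> nat \<Rightarrow> 'a" where
  "flatten q j = q (j div CARD('n)) $ (coords ! (j mod CARD('n)))"

lemma concat_vec_code:
  fixes q :: "nat \<Rightarrow> rat ^ 'n"
  shows "concat (map (\<lambda>n. vec_code (q n)) [0..<m]) =
    concat (map (\<lambda>j. rat_code (flatten q j)) [0..<m * CARD('n)])"
proof (induction m)
  case (Suc m)
  let ?d = "CARD('n)"
  have "vec_code (q m) = concat (map (\<lambda>j. rat_code (flatten q j)) [m * ?d..<m * ?d + ?d])"
    unfolding vec_code_def
  proof (rule arg_cong[of _ _ concat], rule nth_equalityI)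
    fix l assume "l < length (map (\<lambda>i. rat_code (q m $ i)) coords)"
    then have "l < ?d" by (simp add: length_coords)
    then show "map (\<lambda>i. rat_code (q m $ i)) coords ! l =
        map (\<lambda>j. rat_code (flatten q j)) [m * ?d..<m * ?d + ?d] ! l"
      by (simp add: length_coords flatten_def)
  qed (simp add: length_coords)
  moreover have "[0..<Suc m * ?d] = [0..<m * ?d] @ [m * ?d..<m * ?d + ?d]"
    by (metis add.commute mult_Suc upt_add_eq_append zero_le)
  ultimately show ?case using Suc by simp
qed simp

lemma name_code_flatten:
  "name_code q = infinite_concat (\<lambda>j. rat_code (flatten q j))"
  by (rule infinite_concat_unique) (simp_all add: concat_vec_code map_infinite_concat)

text \<open>Dropping \<open>q 0\<close> makes room for the rounding error.\<close>

definition round_name :: "(nat \<Rightarrow> rat ^ 'n) \<Rightarrow> nat \<Rightarrow> rat ^ 'n" where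
  "round_name q n = (\<chi> i. odd_round (n * CARD('n) + (SOME k. k < CARD('n) \<and> coords ! k = i)) (q (Suc n) $ i))"

text \<open>The exponent in \<open>round_name\<close> is the flat index of the coordinate, because
  the transducer doubles its precision after every single rational and knows nothing of vectors. The
  choice operator inverts \<open>coords\<close>, whose elements are distinct.\<close>

lemma flatten_round_name:
  fixes q :: "nat \<Rightarrow> rat ^ 'n"
  shows "flatten (round_name q) j = odd_round j (flatten q (CARD('n) + j))"
proof -
  let ?d = "CARD('n)"
  have "(SOME k. k < ?d \<and> coords ! k = (coords ! (j mod ?d) :: 'n)) = j mod ?d"
  proof (rule some_equality)
    show "j mod ?d < ?d \<and> coords ! (j mod ?d) = (coords ! (j mod ?d) :: 'n)" by simp
    fix k assume "k < ?d \<and> coords ! k = (coords ! (j mod ?d) :: 'n)"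
    then show "k = j mod ?d"
      using nth_eq_iff_index_eq[OF distinct_coords[where 'n = 'n], of k "j mod ?d"] by (simp add: length_coords)
  qed
  then show ?thesis by (simp add: flatten_def round_name_def)
qed

lemma infnorm_le_iff: "infnorm (x :: real ^ 'n) \<le> r \<longleftrightarrow> (\<forall>i. \<bar>x $ i\<bar> \<le> r)"
proof
  assume "\<forall>i. \<bar>x $ i\<bar> \<le> r"
  then show "infnorm x \<le> r" unfolding infnorm_cart by (intro cSup_least) auto
qed (meson component_le_infnorm_cart order_trans)

lemma names_vec_iff:
  "names_vec q (x :: real ^ 'n) \<longleftrightarrow> (\<forall>n i. \<bar>x $ i - of_rat (q n $ i)\<bar> \<le> 1 / 2 ^ n)"
  unfolding names_vec_def infnorm_le_iff by simp

lemma names_round_name: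
  fixes q :: "nat \<Rightarrow> rat ^ 'n"
  assumes q: "names_vec q x"
  shows "names_vec (round_name q) x"
  unfolding names_vec_iff
proof (intro allI)
  fix n and i :: 'n
  define l where "l = n * CARD('n) + (SOME k. k < CARD('n) \<and> coords ! k = i)"
  let ?r = "q (Suc n) $ i"
  have "\<bar>real_of_rat (odd_round l ?r) - of_rat ?r\<bar> = of_rat \<bar>odd_round l ?r - ?r\<bar>"
    unfolding of_rat_diff[symmetric] by (rule abs_of_rat)
  also have "\<dots> \<le> of_rat (1 / 2 ^ Suc l)"
    using odd_round_error of_rat_less_eq by blast
  also have "\<dots> \<le> 1 / 2 ^ Suc n"
  proof -
    \<comment> \<open>The flat index is at least \<open>n\<close> because a vector has at least one
      coordinate, so rounding costs no more than the half of the tolerance saved by the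
      shift.\<close>
    have "n * 1 \<le> n * CARD('n)" by (intro mult_le_mono2) (simp add: Suc_leI)
    then have "Suc n \<le> Suc l" unfolding l_def by linarith
    then have "(2::real) ^ Suc n \<le> 2 ^ Suc l" by (intro power_increasing) auto
    then show ?thesis by (simp add: of_rat_divide of_rat_mult of_rat_power field_simps)
  qed
  finally have 1: "\<bar>real_of_rat (odd_round l ?r) - of_rat ?r\<bar> \<le> 1 / 2 ^ Suc n" .
  have 2: "\<bar>x $ i - of_rat ?r\<bar> \<le> 1 / 2 ^ Suc n"
    using q unfolding names_vec_iff by blast
  have triangle: "\<bar>u - a\<bar> \<le> e + e" if "\<bar>a - b\<bar> \<le> e" "\<bar>u - b\<bar> \<le> e" for u a b e :: real
    using that by linarith
  have "round_name q n $ i = odd_round l ?r" unfolding round_name_def l_def by simp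
  then show "\<bar>x $ i - of_rat (round_name q n $ i)\<bar> \<le> 1 / 2 ^ n"
    using triangle[OF 1 2] by simp
qed

section \<open>Composing a machine with the transducer\<close>

text \<open>
  The two machines run as coroutines.  The control state is that of \<open>M\<close>, so that \<open>M\<close> can query the
  oracle at any time.  The state of the transducer is kept in the single cell of the first tape, and the
  symbol that it emitted last, as long as \<open>M\<close> has not consumed it, in that of the second one.
  The counters of the transducer are the head positions on four tapes that only carry a mark at
  the origin, which is written in the first step of the transducer.
\<close>

definition rounding_compose_delta :: "nat \<Rightarrow> machine \<Rightarrow> nat \<Rightarrow> io_symbol \<Rightarrow> nat list \<Rightarrow> action" where
  "rounding_compose_delta d M s c rs =
    (case rs of ctl # cur # rp # rn # rb # rq # rM \<Rightarrow>
       if cur \<noteq> 0 \<and> set rM \<subseteq> {..<num_symbols M} then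
         (let a = delta M s (nth_symbol (cur - 1)) rM in
          \<lparr>goto = goto a,
           writes = ctl # (if advance a then 0 else cur) # rp # rn # rb # rq # writes a,
           moves = Stay # Stay # Stay # Stay # Stay # Stay # moves a,
           advance = False, emit = emit a, enter = enter a\<rparr>)
       else
         (case rounding_delta d ctl c (rp = 1) (rn = 1) (rb = 1) (rq = 1) of
            (ctl', adv, em, mp, mn, mb, mq) \<Rightarrow>
              let mark = (\<lambda>r. if ctl = 0 then 1 else r) in
              \<lparr>goto = s,
               writes = ctl' # (case em of None \<Rightarrow> 0 | Some c' \<Rightarrow> Suc (symbol_index c')) #
                 mark rp # mark rn # mark rb # mark rq # rM,
               moves = Stay # Stay # mp # mn # mb # mq # replicate (length rM) Stay,
               advance = adv, emit = None, enter = None\<rparr>))"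

definition rounding_compose :: "nat \<Rightarrow> machine \<Rightarrow> machine" where
  "rounding_compose d M = \<lparr>num_states = num_states M, num_symbols = num_symbols M + 13 + d,
     num_tapes = num_tapes M + 6, ask = ask M, yes = yes M, no = no M,
     delta = rounding_compose_delta d M\<rparr>"

text \<open>State 0 is never entered again, so it identifies the very first step. The bound lets
  every state fit into a tape cell.\<close>

lemma rounding_delta_state:
  "fst (rounding_delta d s c p0 n0 b0 q0) \<noteq> 0"
  "s < N \<Longrightarrow> 13 + d \<le> N \<Longrightarrow> fst (rounding_delta d s c p0 n0 b0 q0) < N"
  by (auto simp: rounding_delta_def intro!: Suc_lessI)

text \<open>The common alphabet is larger than that of \<open>M\<close>, so the closure condition
  also covers work symbols for which nothing is known about \<open>delta M\<close>. The test on
  \<open>rM\<close> in the transition function leaves those cases to the transducer.\<close>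

lemma turing_machine_rounding_compose:
  assumes "turing_machine M"
  shows "turing_machine (rounding_compose d M)"
proof -
  let ?D = "rounding_compose_delta d M" and ?S = "num_symbols M + 13 + d"
  have "goto (?D s c rs) < num_states M \<and> length (writes (?D s c rs)) = num_tapes M + 6 \<and>
      set (writes (?D s c rs)) \<subseteq> {..<?S} \<and> length (moves (?D s c rs)) = num_tapes M + 6"
    if s: "s < num_states M" and l: "length rs = num_tapes M + 6" and rs: "set rs \<subseteq> {..<?S}" for s c rs
  proof -
    from l obtain ctl cur rp rn rb rq rM where
      rs_eq [simp]: "rs = ctl # cur # rp # rn # rb # rq # rM" and lM: "length rM = num_tapes M"
      by (auto simp: eval_nat_numeral length_Suc_conv)
    show ?thesis
    proof (cases "cur \<noteq> 0 \<and> set rM \<subseteq> {..<num_symbols M}")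
      case True
      define a where "a = delta M s (nth_symbol (cur - Suc 0)) rM"
      have "goto a < num_states M \<and> length (writes a) = num_tapes M \<and>
          set (writes a) \<subseteq> {..<num_symbols M} \<and> length (moves a) = num_tapes M"
        using assms s lM True unfolding turing_machine_def a_def by blast
      with True rs show ?thesis
        by (auto simp: rounding_compose_delta_def Let_def a_def[symmetric])
    next
      case False
      obtain ctl' adv em mp mn mb mq where
        t: "rounding_delta d ctl c (rp = 1) (rn = 1) (rb = 1) (rq = 1) = (ctl', adv, em, mp, mn, mb, mq)"
        by (metis prod_cases7)
      have "ctl' < ?S"
        using rounding_delta_state(2)[of ctl ?S d c "rp = 1" "rn = 1" "rb = 1" "rq = 1"] rs t by simp
      moreover have "(case em of None \<Rightarrow> 0 | Some c' \<Rightarrow> Suc (symbol_index c')) < ?S"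
      proof -
        have "Suc (symbol_index c') < ?S" for c' using symbol_index_less[of c'] by linarith
        then show ?thesis by (auto split: option.split)
      qed
      moreover have "?D s c rs =
          \<lparr>goto = s,
           writes = ctl' # (case em of None \<Rightarrow> 0 | Some c' \<Rightarrow> Suc (symbol_index c')) #
             (if ctl = 0 then 1 else rp) # (if ctl = 0 then 1 else rn) #
             (if ctl = 0 then 1 else rb) # (if ctl = 0 then 1 else rq) # rM,
           moves = Stay # Stay # mp # mn # mb # mq # replicate (length rM) Stay,
           advance = adv, emit = None, enter = None\<rparr>"
        by (simp only: rs_eq rounding_compose_delta_def list.case if_not_P[OF False] t prod.case Let_def)
      ultimately show ?thesis
        using s rs lM by simp
    qed
  qed
  with assms show ?thesis unfolding turing_machine_def rounding_compose_def by simp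
qed

section \<open>Tapes as counters and the joint simulation\<close>

definition counter_tape :: "nat \<Rightarrow> int \<Rightarrow> tape" where
  "counter_tape s z = ((\<lambda>_. 0)(0 := if s = 0 then 0 else 1), z)"

lemma read_counter: "read_tape (counter_tape s z) = (if s \<noteq> 0 \<and> z = 0 then 1 else 0)"
  by (simp add: counter_tape_def read_tape_def)

text \<open>In state 0 the mark is still missing, but the head stands on the origin, so the first
  step can write it before any counter moves.\<close>

lemma update_counter:
  assumes "s = 0 \<longrightarrow> z = 0" "s' \<noteq> 0"
  shows "update_tape (counter_tape s z) (if s = 0 then 1 else read_tape (counter_tape s z)) m =
    counter_tape s' (z + offset m)"
  using assms by (auto simp: counter_tape_def read_tape_def update_tape_def offset_def fun_eq_iff)

lemma update_counter_Stay:
  "update_tape (counter_tape s z) (read_tape (counter_tape s z)) Stay = counter_tape s z"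
  by (auto simp: counter_tape_def read_tape_def update_tape_def fun_eq_iff)

lemma update_tapes_Stay:
  "map (\<lambda>(T, b, m). update_tape T b m) (zip Ts (zip (map read_tape Ts) (replicate (length Ts) Stay))) = Ts"
  by (induction Ts) (simp_all add: update_tape_def read_tape_def)

definition joint_config :: "config \<Rightarrow> nat \<Rightarrow> tconfig \<Rightarrow> config" where
  "joint_config C cur x = (case x of (s, i, p, n, b, q, out) \<Rightarrow>
     \<lparr>state = state C, position = i,
      tapes = cell s # cell cur # counter_tape s p # counter_tape s n # counter_tape s b #
        counter_tape s q # tapes C,
      query = query C, written = written C\<rparr>)"

definition well_formed :: "machine \<Rightarrow> config \<Rightarrow> bool" where
  "well_formed M C \<longleftrightarrow> state C < num_states M \<and> length (tapes C) = num_tapes M \<and>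
     (\<forall>T\<in>set (tapes C). \<forall>z. fst T z < num_symbols M)"

text \<open>The work tapes of \<open>M\<close> never leave its alphabet, so in a real run the test
  on \<open>rM\<close> succeeds and a waiting symbol reaches \<open>M\<close>.\<close>

lemma well_formed_run:
  assumes M: "turing_machine M"
  shows "well_formed M (run A M w t)"
proof (induction t)
  case 0
  show ?case using M by (auto simp: run_def initial_def well_formed_def turing_machine_def)
next
  case (Suc t)
  define C where "C = run A M w t"
  have C: "well_formed M C" using Suc unfolding C_def .
  have "well_formed M (step A M w C)"
  proof (cases "state C = ask M")
    case True
    then show ?thesis using C M by (simp add: step_def well_formed_def turing_machine_def)
  next
    case False
    define a where "a = delta M (state C) (w (position C)) (map read_tape (tapes C))"
    have "set (map read_tape (tapes C)) \<subseteq> {..<num_symbols M}"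
      using C by (auto simp: well_formed_def read_tape_def)
    then have a: "goto a < num_states M \<and> length (writes a) = num_tapes M \<and>
          set (writes a) \<subseteq> {..<num_symbols M} \<and> length (moves a) = num_tapes M"
      using C M unfolding turing_machine_def a_def well_formed_def by simp
    have "fst (update_tape T b m) z < num_symbols M"
      if "(T, b, m) \<in> set (zip (tapes C) (zip (writes a) (moves a)))" for T b m z
    proof -
      have "T \<in> set (tapes C)" "b \<in> set (writes a)"
        using that by (meson in_set_zipE)+
      with C a show ?thesis by (auto simp: well_formed_def update_tape_def)
    qed
    with a C False show ?thesis
      by (auto simp: step_def well_formed_def a_def[symmetric] Let_def)
  qed
  then show ?case by (simp add: C_def run_Suc)
qed

lemma joint_step_ask:
  assumes "state C = ask M"
  shows "step A (rounding_compose d M) w (joint_config C cur x) = joint_config (step A M w' C) cur x"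
  using assms by (simp add: step_def joint_config_def rounding_compose_def split: prod.split)

lemma joint_step_machine:
  assumes "state C \<noteq> ask M" "cur = Suc (symbol_index (w' (position C)))" "well_formed M C"
  shows "step A (rounding_compose d M) w (joint_config C cur x) =
    joint_config (step A M w' C) (if position (step A M w' C) = position C then cur else 0) x"
proof -
  have "set (map read_tape (tapes C)) \<subseteq> {..<num_symbols M}"
    using assms(3) by (auto simp: well_formed_def read_tape_def)
  then show ?thesis
    using assms(1,2)
    by (cases x) (simp add: step_def joint_config_def rounding_compose_def rounding_compose_delta_def
        Let_def update_counter_Stay image_subset_iff)
qed

lemma joint_step_transducer:
  assumes "state C \<noteq> ask M" and x: "x = (s, i, p, n, b, q, out)"
    and 0: "s = 0 \<longrightarrow> p = 0 \<and> n = 0 \<and> b = 0 \<and> q = 0"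
  shows "\<exists>em. step A (rounding_compose d M) w (joint_config C 0 x) =
      joint_config C (case em of None \<Rightarrow> 0 | Some c \<Rightarrow> Suc (symbol_index c)) (rounding_step d w x) \<and>
    tconfig_output (rounding_step d w x) = out @ (case em of None \<Rightarrow> [] | Some c \<Rightarrow> [c])"
proof -
  let ?t = "\<lambda>z. read_tape (counter_tape s z) = 1"
  obtain s' adv em mp mn mb mq where
    t: "rounding_delta d s (w i) (?t p) (?t n) (?t b) (?t q) = (s', adv, em, mp, mn, mb, mq)"
    by (metis prod_cases7)
  have s': "s' \<noteq> 0" using rounding_delta_state(1)[of d s "w i" "?t p" "?t n" "?t b" "?t q"] t by simp
  \<comment> \<open>In state 0 the tests read false although the counters are 0, as the marks are
    missing; the transition out of state 0 ignores them.\<close>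
  have t': "rounding_delta d s (w i) (p = 0) (n = 0) (b = 0) (q = 0) = (s', adv, em, mp, mn, mb, mq)"
  proof (cases "s = 0")
    case True
    then show ?thesis using t by (simp add: rounding_delta_def)
  next
    case False
    then have "?t z \<longleftrightarrow> z = 0" for z by (simp add: read_counter)
    then show ?thesis using t by simp
  qed
  have "step A (rounding_compose d M) w (joint_config C 0 x) =
      joint_config C (case em of None \<Rightarrow> 0 | Some c \<Rightarrow> Suc (symbol_index c)) (rounding_step d w x)"
    using assms(1) update_counter[of s _ s'] 0 s'
    by (simp add: x t' t step_def joint_config_def rounding_compose_def rounding_compose_delta_def Let_def
        update_tapes_Stay del: One_nat_def)
  moreover have "tconfig_output (rounding_step d w x) = out @ (case em of None \<Rightarrow> [] | Some c \<Rightarrow> [c])"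
    by (simp add: x t' tconfig_output_def)
  ultimately show ?thesis by blast
qed

abbreviation rounding_init :: tconfig where
  "rounding_init \<equiv> (0, 0, 0, 0, 0, 0, [])"

lemma rounding_state_0:
  assumes "(rounding_step d w ^^ k) rounding_init = (s, i, p, n, b, q, out)"
  shows "s = 0 \<longrightarrow> p = 0 \<and> n = 0 \<and> b = 0 \<and> q = 0"
proof (cases k)
  case 0
  with assms show ?thesis by simp
next
  case (Suc k')
  obtain s0 i0 p0 n0 b0 q0 out0 where x: "(rounding_step d w ^^ k') rounding_init = (s0, i0, p0, n0, b0, q0, out0)"
    by (metis prod_cases7)
  with assms Suc have "s = fst (rounding_delta d s0 (w i0) (p0 = 0) (n0 = 0) (b0 = 0) (q0 = 0))"
    by (auto split: prod.splits)
  then show ?thesis using rounding_delta_state(1) by metis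
qed

text \<open>
  Here \<open>w'\<close> is the word that the transducer produces.  Either \<open>M\<close> has consumed all of the \<open>l\<close>
  symbols produced so far, or it is scanning the last one of them.
\<close>

definition joint_reached ::
  "bool list set \<Rightarrow> nat \<Rightarrow> machine \<Rightarrow> (nat \<Rightarrow> io_symbol) \<Rightarrow> (nat \<Rightarrow> io_symbol) \<Rightarrow> nat \<Rightarrow> nat \<Rightarrow> nat \<Rightarrow> bool" where
  "joint_reached A d M w w' t k cur \<longleftrightarrow>
     (\<exists>t'. run A (rounding_compose d M) w t' =
        joint_config (run A M w' t) cur ((rounding_step d w ^^ k) rounding_init)) \<and>
     (let i = position (run A M w' t); l = length (tconfig_output ((rounding_step d w ^^ k) rounding_init)) in
        cur = 0 \<and> l = i \<or> cur = Suc (symbol_index (w' i)) \<and> l = Suc i)"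

lemma joint_reached_transducer:
  assumes reached: "joint_reached A d M w w' t k 0" and ask: "state (run A M w' t) \<noteq> ask M"
    and w': "\<And>k. tconfig_output ((rounding_step d w ^^ k) rounding_init) =
        map w' [0..<length (tconfig_output ((rounding_step d w ^^ k) rounding_init))]"
  shows "\<exists>cur. joint_reached A d M w w' t (Suc k) cur"
proof -
  let ?x = "\<lambda>k. (rounding_step d w ^^ k) rounding_init"
  let ?C = "run A M w' t"
  obtain s i p n b q out where x: "?x k = (s, i, p, n, b, q, out)"
    by (metis prod_cases7)
  from reached obtain t' where t': "run A (rounding_compose d M) w t' = joint_config ?C 0 (?x k)"
    and l: "length out = position ?C"
    unfolding joint_reached_def x Let_def tconfig_output_def by auto
  obtain em where step: "step A (rounding_compose d M) w (joint_config ?C 0 (?x k)) =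
      joint_config ?C (case em of None \<Rightarrow> 0 | Some c \<Rightarrow> Suc (symbol_index c)) (?x (Suc k))"
    and out: "tconfig_output (?x (Suc k)) = out @ (case em of None \<Rightarrow> [] | Some c \<Rightarrow> [c])"
    using joint_step_transducer[OF ask x rounding_state_0[OF x], of A d w]
    unfolding funpow.simps comp_apply by blast
  have "run A (rounding_compose d M) w (Suc t') =
      joint_config ?C (case em of None \<Rightarrow> 0 | Some c \<Rightarrow> Suc (symbol_index c)) (?x (Suc k))"
    unfolding run_Suc t' step ..
  moreover have "c = w' (position ?C)" if "em = Some c" for c
  proof -
    have "out @ [c] = map w' [0..<length (out @ [c])]"
      using w'[of "Suc k"] unfolding out that by (simp only: option.case)
    then have "(out @ [c]) ! length out = map w' [0..<length (out @ [c])] ! length out" by (rule arg_cong)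
    then show ?thesis using l by (simp add: nth_append)
  qed
  ultimately show ?thesis
    using l out unfolding joint_reached_def Let_def by (cases em) auto
qed

text \<open>The transducer may take many silent steps before it emits, and the buffer holds one
  symbol; \<open>e\<close> bounds how long it has to run until the scanned position is
  filled.\<close>

lemma joint_reached_consumable:
  assumes "joint_reached A d M w w' t k 0" and ask: "state (run A M w' t) \<noteq> ask M"
    and w': "\<And>k. tconfig_output ((rounding_step d w ^^ k) rounding_init) =
        map w' [0..<length (tconfig_output ((rounding_step d w ^^ k) rounding_init))]"
    and "position (run A M w' t) < length (tconfig_output ((rounding_step d w ^^ (k + e)) rounding_init))"
  shows "\<exists>k cur. cur \<noteq> 0 \<and> joint_reached A d M w w' t k cur"
  using assms(1,4)
proof (induction e arbitrary: k)
  case 0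
  then show ?case unfolding joint_reached_def Let_def by simp
next
  case (Suc e)
  obtain cur where cur: "joint_reached A d M w w' t (Suc k) cur"
    using joint_reached_transducer[OF Suc.prems(1) ask w'] by blast
  show ?case
  proof (cases "cur = 0")
    case True
    with cur Suc.IH[of "Suc k"] Suc.prems(2) show ?thesis by simp
  next
    case False
    with cur show ?thesis by blast
  qed
qed

lemma prefix_tconfig_output:
  assumes "k \<le> k'"
  shows "prefix (tconfig_output ((rounding_step d w ^^ k) x)) (tconfig_output ((rounding_step d w ^^ k') x))"
  using assms
proof (induction k' rule: dec_induct)
  case (step m)
  have "prefix (tconfig_output y) (tconfig_output (rounding_step d w y))" for y
    by (cases y) (auto simp: tconfig_output_def split: prod.split)
  from prefix_order.trans[OF step.IH this[of "(rounding_step d w ^^ m) x"]] show ?case by simp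
qed simp

text \<open>Induction over the steps of \<open>M\<close>. A query step needs no input and is copied
  at once. Before any other step the transducer is run until the scanned symbol is in the buffer,
  which is emptied exactly when \<open>M\<close> advances.\<close>

lemma joint_run:
  assumes M: "turing_machine M"
    and w': "\<And>k. tconfig_output ((rounding_step d w ^^ k) rounding_init) =
        map w' [0..<length (tconfig_output ((rounding_step d w ^^ k) rounding_init))]"
    and unbounded: "\<And>l. \<exists>k. l < length (tconfig_output ((rounding_step d w ^^ k) rounding_init))"
  shows "\<exists>k cur. joint_reached A d M w w' t k cur"
proof (induction t)
  case 0
  have "run A (rounding_compose d M) w 0 = joint_config (run A M w' 0) 0 rounding_init"
    by (simp add: run_def initial_def joint_config_def rounding_compose_def counter_tape_def
        numeral_eq_Suc fun_eq_iff)
  then have "run A (rounding_compose d M) w 0 =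
      joint_config (run A M w' 0) 0 ((rounding_step d w ^^ 0) rounding_init)"
    by simp
  moreover have "length (tconfig_output ((rounding_step d w ^^ 0) rounding_init)) = position (run A M w' 0)"
    by (simp add: tconfig_output_def run_def initial_def)
  ultimately have "joint_reached A d M w w' 0 0 0"
    unfolding joint_reached_def Let_def by metis
  then show ?case by (intro exI)
next
  case (Suc t)
  let ?C = "run A M w' t"
  let ?x = "\<lambda>k. (rounding_step d w ^^ k) rounding_init"
  from Suc obtain k cur where reached: "joint_reached A d M w w' t k cur" by blast
  show ?case
  proof (cases "state ?C = ask M")
    case True
    from reached obtain t' where t': "run A (rounding_compose d M) w t' = joint_config ?C cur (?x k)"
      unfolding joint_reached_def by blast
    have "run A (rounding_compose d M) w (Suc t') = joint_config (run A M w' (Suc t)) cur (?x k)"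
      unfolding run_Suc t' by (rule joint_step_ask[OF True])
    moreover have "position (run A M w' (Suc t)) = position ?C"
      using True by (simp add: run_Suc step_def)
    ultimately show ?thesis using reached unfolding joint_reached_def by metis
  next
    case False
    have "\<exists>k cur. cur \<noteq> 0 \<and> joint_reached A d M w w' t k cur"
    proof (cases "cur = 0")
      case True
      obtain k' where "position ?C < length (tconfig_output (?x k'))" using unbounded by blast
      also have "\<dots> \<le> length (tconfig_output (?x (k + k')))" 
        by (intro prefix_length_le prefix_tconfig_output) simp
      finally show ?thesis
        using joint_reached_consumable[OF _ False w'] reached unfolding True by blast
    qed (use reached in blast)
    then obtain k cur where cur: "cur \<noteq> 0" and r: "joint_reached A d M w w' t k cur" by blast
    then obtain t' where t': "run A (rounding_compose d M) w t' = joint_config ?C cur (?x k)"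
      and c: "cur = Suc (symbol_index (w' (position ?C)))"
      and l: "length (tconfig_output (?x k)) = Suc (position ?C)"
      unfolding joint_reached_def Let_def by auto
    let ?cur = "if position (run A M w' (Suc t)) = position ?C then cur else 0"
    have run: "run A (rounding_compose d M) w (Suc t') = joint_config (run A M w' (Suc t)) ?cur (?x k)"
      unfolding run_Suc t' by (rule joint_step_machine[where C = ?C and w' = w', OF False c well_formed_run[OF M]])
    have "position (step A M w' C) = position C \<or> position (step A M w' C) = Suc (position C)" for C
      by (simp add: step_def Let_def)
    then consider "position (run A M w' (Suc t)) = position ?C" | "position (run A M w' (Suc t)) = Suc (position ?C)"
      unfolding run_Suc by blast
    then have "joint_reached A d M w w' (Suc t) k ?cur"
    proof cases
      case 1
      with run c l show ?thesis unfolding joint_reached_def Let_def by metis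
    next
      case 2
      then have "?cur = 0" by simp
      moreover have "length (tconfig_output (?x k)) = position (run A M w' (Suc t))"
        unfolding l 2 ..
      ultimately show ?thesis using run unfolding joint_reached_def Let_def by metis
    qed
    then show ?thesis by (intro exI)
  qed
qed

lemma outputs_rounding_compose:
  fixes q :: "nat \<Rightarrow> rat ^ 'n"
  assumes M: "turing_machine M" and p: "outputs A M (name_code (round_name q)) p"
  shows "outputs A (rounding_compose CARD('n) M) (name_code q) p"
proof -
  let ?d = "CARD('n)"
  define w where "w = name_code q"
  define w' where "w' = name_code (round_name q)"
  let ?out = "\<lambda>k. tconfig_output ((rounding_step ?d w ^^ k) rounding_init)"
  define ws where "ws = (\<lambda>j. rat_code (flatten (round_name q) j))"
  have w'_ws: "map w' [0..<length (concat (map ws [0..<m]))] = concat (map ws [0..<m])" for m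
    unfolding w'_def name_code_flatten ws_def by (rule map_infinite_concat) simp
  have ex: "\<exists>k. ?out k = concat (map ws [0..<m])" for m
    using rounding_outputs[of ?d "flatten q" m] unfolding w_def name_code_flatten ws_def flatten_round_name
    by simp
  have len: "m \<le> length (concat (map ws [0..<m]))" for m
    by (rule length_concat_upt_ge) (simp add: ws_def)
  note mono = prefix_tconfig_output[where d = ?d and w = w and x = rounding_init]
  have out: "?out k = map w' [0..<length (?out k)]" for k
  proof -
    \<comment> \<open>So many codes are longer than the output at time \<open>k\<close>, which
      forces the time \<open>k'\<close> of their completion beyond \<open>k\<close>.\<close>
    define m where "m = Suc (length (?out k))"
    obtain k' where k': "?out k' = concat (map ws [0..<m])" using ex by blast
    have "\<not> k' \<le> k"
    proof
      assume "k' \<le> k"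
      from prefix_length_le[OF mono[OF this]] len[of m] show False unfolding k' m_def by linarith
    qed
    then have "prefix (?out k) (map w' [0..<length (concat (map ws [0..<m]))])"
      using mono[of k k'] unfolding k' w'_ws by simp
    then show ?thesis unfolding prefix_map_upt_iff by blast
  qed
  have unbounded: "\<exists>k. l < length (?out k)" for l
    using ex[of "Suc l"] len[of "Suc l"] by (metis Suc_le_eq)
  show ?thesis
    unfolding outputs_def
  proof
    fix m
    obtain t where t: "prefix (concat (map (\<lambda>i. rat_code (p i)) [0..<m])) (written (run A M w' t))"
      using p unfolding outputs_def w'_def by blast
    obtain k cur where "joint_reached A ?d M w w' t k cur"
      using joint_run[OF M out unbounded] by blast
    then obtain t' where t': "run A (rounding_compose ?d M) w t' =
        joint_config (run A M w' t) cur ((rounding_step ?d w ^^ k) rounding_init)"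
      unfolding joint_reached_def by blast
    have "written (run A (rounding_compose ?d M) w t') = written (run A M w' t)"
      unfolding t' joint_config_def by (simp split: prod.split)
    with t show "\<exists>t. prefix (concat (map (\<lambda>i. rat_code (p i)) [0..<m]))
        (written (run A (rounding_compose ?d M) (name_code q) t))"
      unfolding w_def by metis
  qed
qed

section \<open>Compactness of the space of names\<close>

definition machine_value :: "bool list set \<Rightarrow> machine \<Rightarrow> (nat \<Rightarrow> rat ^ 'n) \<Rightarrow> real \<Rightarrow> bool" where
  "machine_value A M a y \<longleftrightarrow> (\<exists>p. outputs A M (name_code a) p \<and> names_real p y)"

lemma name_code_cong:
  assumes "\<And>i. i < t \<Longrightarrow> a i = a' i" "k < t"
  shows "name_code a k = name_code a' k"
proof -
  have "map (\<lambda>n. vec_code (a n)) [0..<Suc k] = map (\<lambda>n. vec_code (a' n)) [0..<Suc k]"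
    by (rule map_cong) (use assms in auto)
  then show ?thesis unfolding infinite_concat_def by (simp only:)
qed

text \<open>A finite piece of output is written within some time \<open>t\<close>, and the symbols
  scanned by then depend only on the first \<open>t\<close> entries.\<close>

lemma outputs_finite_use:
  fixes a :: "nat \<Rightarrow> rat ^ 'n"
  assumes "outputs A M (name_code a) p"
  shows "\<exists>N. \<forall>a' p'. (\<forall>i<N. a' i = a i) \<and> outputs A M (name_code a') p' \<longrightarrow> (\<forall>i<m. p' i = p i)"
proof -
  let ?codes = "\<lambda>p. concat (map (\<lambda>i. rat_code (p i)) [0..<m])"
  obtain t where t: "prefix (?codes p) (written (run A M (name_code a) t))"
    using assms unfolding outputs_def by blast
  have "p' i = p i" if a': "\<forall>i<t. a' i = a i" and p': "outputs A M (name_code a') p'" and i: "i < m" for a' p' i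
  proof -
    have "run A M (name_code a') t = run A M (name_code a) t"
      by (rule run_cong) (use a' name_code_cong[of t a' a] in blast)
    with t have t': "prefix (?codes p) (written (run A M (name_code a') t))" by simp
    obtain s where s: "prefix (?codes p') (written (run A M (name_code a') s))"
      using p' unfolding outputs_def by blast
    have "prefix (?codes p) (written (run A M (name_code a') (max s t)))"
      "prefix (?codes p') (written (run A M (name_code a') (max s t)))"
      using t' s prefix_written_run[of _ "max s t" A M] prefix_order.trans by (meson max.cobounded1 max.cobounded2)+
    then show ?thesis using prefix_free_upt[OF prefix_free_rat_code i] by metis
  qed
  then show ?thesis by blast
qed

lemma machine_value_close:
  fixes a :: "nat \<Rightarrow> rat ^ 'n"
  assumes "machine_value A M a y"
  shows "\<exists>N. \<forall>a' y'. (\<forall>i<N. a' i = a i) \<and> machine_value A M a' y' \<longrightarrow> \<bar>y' - y\<bar> \<le> 2 / 2 ^ m"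
proof -
  obtain p where p: "outputs A M (name_code a) p" "names_real p y"
    using assms unfolding machine_value_def by blast
  obtain N where N: "\<And>a' p'. (\<forall>i<N. a' i = a i) \<and> outputs A M (name_code a') p' \<Longrightarrow> \<forall>i<Suc m. p' i = p i"
    using outputs_finite_use[OF p(1), of "Suc m"] by blast
  have "\<bar>y' - y\<bar> \<le> 2 / 2 ^ m" if a': "\<forall>i<N. a' i = a i" and y': "machine_value A M a' y'" for a' y'
  proof -
    obtain p' where p': "outputs A M (name_code a') p'" "names_real p' y'"
      using y' unfolding machine_value_def by blast
    have "p' m = p m" using N a' p'(1) by blast
    then have "\<bar>y - of_rat (p m)\<bar> \<le> 1 / 2 ^ m" "\<bar>y' - of_rat (p m)\<bar> \<le> 1 / 2 ^ m"
      using p(2) p'(2) unfolding names_real_def by metis+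
    then have "\<bar>y' - y\<bar> \<le> 1 / 2 ^ m + 1 / 2 ^ m" by linarith
    then show ?thesis by simp
  qed
  then show ?thesis by blast
qed

text \<open>Names converge in the product of discrete spaces: each entry is eventually
  constant.\<close>

lemma machine_value_continuous:
  fixes a :: "nat \<Rightarrow> rat ^ 'n"
  assumes y: "machine_value A M a y" and Y: "\<And>k. machine_value A M (b k) (Y k)"
    and b: "\<And>n. \<forall>\<^sub>F k in sequentially. b k n = a n"
  shows "Y \<longlonglongrightarrow> y"
proof (rule tendstoI)
  fix e :: real assume "e > 0"
  obtain m where m: "(1/2) ^ m < e / 2" using real_arch_pow_inv[of "e/2" "1/2"] \<open>e > 0\<close> by auto
  obtain N where N: "\<And>a' y'. (\<forall>i<N. a' i = a i) \<and> machine_value A M a' y' \<Longrightarrow> \<bar>y' - y\<bar> \<le> 2 / 2 ^ m"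
    using machine_value_close[OF y, of m] by blast
  have "\<forall>\<^sub>F k in sequentially. \<forall>i\<in>{..<N}. b k i = a i"
    by (intro eventually_ball_finite) (use b in auto)
  then show "\<forall>\<^sub>F k in sequentially. dist (Y k) y < e"
  proof eventually_elim
    case (elim k)
    then have "\<bar>Y k - y\<bar> \<le> 2 / 2 ^ m" using N Y by blast
    also have "\<dots> < e" using m by (simp add: power_divide field_simps)
    finally show ?case by (simp add: dist_real_def)
  qed
qed

text \<open>Sequential compactness of a countable product of finite discrete spaces: the pigeonhole
  principle fixes one entry at a time, and the diagonal sequence fixes all of them
  eventually.\<close>

lemma pointwise_constant_subsequence:
  fixes a :: "nat \<Rightarrow> nat \<Rightarrow> 'b"
  assumes fin: "\<And>n. finite (D n)" and D: "\<And>k n. a k n \<in> D n"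
  shows "\<exists>r b. strict_mono r \<and> (\<forall>n. \<forall>\<^sub>F k in sequentially. a (r k) n = b n)"
proof -
  define P where "P n s \<longleftrightarrow> (\<exists>c. \<forall>k. a (s k) n = c)" for n and s :: "nat \<Rightarrow> nat"
  interpret subseqs P
  proof
    fix n and s :: "nat \<Rightarrow> nat" assume "strict_mono s"
    have "finite ((\<lambda>k. a (s k) n) ` UNIV)" by (rule finite_subset[OF _ fin[of n]]) (use D in auto)
    from pigeonhole_infinite[OF _ this] obtain k0 where inf: "infinite {k. a (s k) n = a (s k0) n}"
      by auto
    have "\<forall>k. a (s (enumerate {k. a (s k) n = a (s k0) n} k)) n = a (s k0) n"
      using enumerate_in_set[OF inf] by blast
    with strict_mono_enumerate[OF inf] show "\<exists>r'. strict_mono r' \<and> P n (s \<circ> r')"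
      unfolding P_def comp_def by blast
  qed
  have "P n (diagseq \<circ> ((+) (Suc n)))" for n
    by (rule diagseq_holds) (auto simp: P_def)
  then obtain b where b: "\<And>n k. a (diagseq (Suc n + k)) n = b n"
    unfolding P_def comp_def by metis
  have "\<forall>\<^sub>F k in sequentially. a (diagseq k) n = b n" for n
    unfolding eventually_sequentially using b[of n] by (metis le_Suc_ex)
  with subseq_diagseq show ?thesis by blast
qed

text \<open>The exponents may vary with the coordinate because rounding follows the flat index; part
  (b) takes the same exponent in all coordinates.\<close>

definition grid_name :: "(nat \<Rightarrow> 'n \<Rightarrow> nat) \<Rightarrow> (nat \<Rightarrow> rat ^ 'n) \<Rightarrow> bool" where
  "grid_name e a \<longleftrightarrow> (\<forall>n i. \<exists>z::int. a n $ i = of_int z / 2 ^ e n i)"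

lemma finite_bounded_grid: "finite {r::rat. (\<exists>z::int. r = of_int z / 2 ^ j) \<and> \<bar>real_of_rat r\<bar> \<le> R}"
proof (rule finite_subset)
  let ?B = "\<lceil>R * 2 ^ j\<rceil>"
  show "{r::rat. (\<exists>z::int. r = of_int z / 2 ^ j) \<and> \<bar>real_of_rat r\<bar> \<le> R} \<subseteq>
      (\<lambda>z. of_int z / 2 ^ j) ` {- ?B..?B}"
  proof
    fix r :: rat assume "r \<in> {r. (\<exists>z::int. r = of_int z / 2 ^ j) \<and> \<bar>real_of_rat r\<bar> \<le> R}"
    then obtain z :: int where z: "r = of_int z / 2 ^ j" and "\<bar>real_of_rat r\<bar> \<le> R" by blast
    then have "\<bar>real_of_rat r\<bar> * 2 ^ j \<le> R * 2 ^ j" by (intro mult_right_mono) auto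
    moreover have "real_of_int z = real_of_rat r * 2 ^ j"
      unfolding z by (simp add: of_rat_divide of_rat_power)
    ultimately have "\<bar>real_of_int z\<bar> \<le> R * 2 ^ j" by (simp add: abs_mult del: abs_of_rat)
    also have "\<dots> \<le> of_int ?B" by (rule le_of_int_ceiling)
    finally have "\<bar>z\<bar> \<le> ?B" by linarith
    then have "z \<in> {- ?B..?B}" unfolding atLeastAtMost_iff by linarith
    then show "r \<in> (\<lambda>z. of_int z / 2 ^ j) ` {- ?B..?B}" unfolding z by (rule imageI)
  qed
qed simp

lemma finite_vec_components:
  assumes "\<And>i::'n::finite. finite (F i)"
  shows "finite {v :: 'b ^ 'n. \<forall>i. v $ i \<in> F i}"
proof (rule finite_subset)
  show "{v :: 'b ^ 'n. \<forall>i. v $ i \<in> F i} \<subseteq> vec_lambda ` (PiE UNIV F)"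
  proof
    fix v :: "'b ^ 'n" assume "v \<in> {v. \<forall>i. v $ i \<in> F i}"
    then have "v = vec_lambda (vec_nth v)" "vec_nth v \<in> PiE UNIV F" by auto
    then show "v \<in> vec_lambda ` (PiE UNIV F)" by blast
  qed
  show "finite (vec_lambda ` (PiE UNIV F))" by (intro finite_imageI finite_PiE) (use assms in auto)
qed

text \<open>Along a subsequence the points converge and every entry of their names settles. The
  inequalities of \<open>names_vec\<close> are closed, so the limit is a name of the limit
  point.\<close>

lemma names_subsequence:
  fixes S :: "(real ^ 'n) set" and X :: "nat \<Rightarrow> real ^ 'n"
  assumes S: "compact S" and X: "\<And>k. X k \<in> S" and names: "\<And>k. names_vec (a k) (X k)"
    and grid: "\<And>k. grid_name e (a k)"
  shows "\<exists>r x b. strict_mono r \<and> x \<in> S \<and> names_vec b x \<and> (\<forall>n. \<forall>\<^sub>F k in sequentially. a (r k) n = b n)"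
proof -
  obtain R where R: "\<And>x. x \<in> S \<Longrightarrow> norm x \<le> R"
    using compact_imp_bounded[OF S] unfolding bounded_iff by blast
  define D where "D n = {v :: rat ^ 'n. \<forall>i. v $ i \<in>
    {r. (\<exists>z::int. r = of_int z / 2 ^ e n i) \<and> \<bar>real_of_rat r\<bar> \<le> R + 1}}" for n
  have fin: "finite (D n)" for n
    unfolding D_def by (intro finite_vec_components finite_bounded_grid)
  have "\<bar>real_of_rat (a k n $ i)\<bar> \<le> R + 1" for k n i
  proof -
    have "\<bar>X k $ i\<bar> \<le> R" using component_le_norm_cart[of "X k" i] R[OF X[of k]] by linarith
    moreover have "\<bar>X k $ i - of_rat (a k n $ i)\<bar> \<le> 1 / 2 ^ n" using names[of k] unfolding names_vec_iff by blast
    moreover have "1 / 2 ^ n \<le> (1::real)" by (simp add: field_simps)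
    ultimately show ?thesis by linarith
  qed
  then have D: "a k n \<in> D n" for k n
    using grid[of k] unfolding D_def grid_name_def by blast
  obtain x r1 where x: "x \<in> S" and r1: "strict_mono r1" and lim1: "(X \<circ> r1) \<longlonglongrightarrow> x"
    using S[unfolded compact_def, rule_format, of X] X by blast
  obtain r2 b where r2: "strict_mono r2" and b: "\<And>n. \<forall>\<^sub>F k in sequentially. a (r1 (r2 k)) n = b n"
    using pointwise_constant_subsequence[of D "\<lambda>k. a (r1 k)", OF fin D] by blast
  have lim: "(\<lambda>k. X (r1 (r2 k))) \<longlonglongrightarrow> x"
    using LIMSEQ_subseq_LIMSEQ[OF lim1 r2] by (simp add: comp_def)
  have "\<bar>x $ i - of_rat (b n $ i)\<bar> \<le> 1 / 2 ^ n" for n i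
  proof (rule tendsto_upperbound)
    show "(\<lambda>k. \<bar>X (r1 (r2 k)) $ i - of_rat (b n $ i)\<bar>) \<longlonglongrightarrow> \<bar>x $ i - of_rat (b n $ i)\<bar>"
      by (intro tendsto_intros lim)
    show "\<forall>\<^sub>F k in sequentially. \<bar>X (r1 (r2 k)) $ i - of_rat (b n $ i)\<bar> \<le> 1 / 2 ^ n"
      using b[of n]
    proof eventually_elim
      case (elim k)
      then show ?case using names[of "r1 (r2 k)"] unfolding names_vec_iff by metis
    qed
  qed simp
  then have "names_vec b x" unfolding names_vec_iff by blast
  moreover have "strict_mono (r1 \<circ> r2)" using r1 r2 by (rule strict_mono_o)
  ultimately show ?thesis using x b by (intro exI[of _ "r1 \<circ> r2"] exI[of _ x] exI[of _ b]) auto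
qed

definition computes :: "bool list set \<Rightarrow> machine \<Rightarrow> ((real ^ 'n) \<times> real) set \<Rightarrow> bool" where
  "computes A M f \<longleftrightarrow> turing_machine M \<and>
     (\<forall>x\<in>Domain f. \<forall>q. names_vec q x \<longrightarrow> (\<exists>y\<in>f `` {x}. machine_value A M q y))"

lemma computable_relative_to_iff:
  fixes f :: "((real ^ 'n) \<times> real) set"
  shows "computable_relative_to A f \<longleftrightarrow> (\<exists>M. computes A M f)"
proof -
  have "(\<exists>p. outputs A M (name_code q) p \<and> (\<exists>y\<in>f `` {x}. names_real p y)) \<longleftrightarrow>
      (\<exists>y\<in>f `` {x}. machine_value A M q y)" for M x and q :: "nat \<Rightarrow> rat ^ 'n"
    unfolding machine_value_def by blast
  then show ?thesis unfolding computable_relative_to_def computes_def by (simp only:)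
qed

lemma names_vec_exists: "\<exists>q. names_vec q (x :: real ^ 'n)"
proof -
  have "\<exists>r. \<bar>x $ i - of_rat r\<bar> \<le> 1 / 2 ^ n" for n i
  proof -
    obtain r where "x $ i < of_rat r" "of_rat r < x $ i + 1 / 2 ^ n"
      using of_rat_dense[of "x $ i" "x $ i + 1 / 2 ^ n"] by auto
    then have "\<bar>x $ i - of_rat r\<bar> \<le> 1 / 2 ^ n" by linarith
    then show ?thesis ..
  qed
  then have "\<bar>x $ i - of_rat (SOME r. \<bar>x $ i - of_rat r\<bar> \<le> 1 / 2 ^ n)\<bar> \<le> 1 / 2 ^ n" for n i
    by (rule someI_ex)
  then have "names_vec (\<lambda>n. \<chi> i. SOME r. \<bar>x $ i - of_rat r\<bar> \<le> 1 / 2 ^ n) x"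
    unfolding names_vec_iff by simp
  then show ?thesis by (intro exI)
qed


section \<open>Tightening to compact images\<close>

lemma tightening:
  fixes f :: "((real ^ 'n) \<times> real) set"
  assumes "computable_relative_to A f"
  shows "\<exists>g. Domain g = Domain f \<and> tightens g f \<and> computable_relative_to A g \<and> maps_compact_to_compact g"
proof -
  obtain M where M: "computes A M f" using assms unfolding computable_relative_to_iff by blast
  \<comment> \<open>This is the exponent of the denominator that \<open>odd_round\<close> produces,
    one more than the flat index.\<close>
  define e where "e n i = Suc (n * CARD('n) + (SOME k. k < CARD('n) \<and> coords ! k = i))" for n and i :: 'n
  define g where "g = {(x, y). (x, y) \<in> f \<and> (\<exists>a. names_vec a x \<and> grid_name e a \<and> machine_value A M a y)}"
  have grid: "grid_name e (round_name q)" for q :: "nat \<Rightarrow> rat ^ 'n"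
    unfolding grid_name_def e_def round_name_def by (simp add: odd_round_grid del: power_Suc)
  have val: "\<exists>y\<in>g `` {x}. machine_value A M (round_name q) y" if "x \<in> Domain f" "names_vec q x" for x q
    using M that names_round_name[OF that(2)] grid[of q] unfolding computes_def g_def by blast
  have dom: "Domain g = Domain f"
  proof
    show "Domain g \<subseteq> Domain f" unfolding g_def by blast
    show "Domain f \<subseteq> Domain g" using val names_vec_exists by blast
  qed
  have "tightens g f" unfolding tightens_def dom unfolding g_def by blast
  moreover have "computes A (rounding_compose CARD('n) M) g"
    unfolding computes_def dom
  proof (intro conjI ballI allI impI)
    have tm: "turing_machine M" using M unfolding computes_def by blast
    then show "turing_machine (rounding_compose CARD('n) M)" by (rule turing_machine_rounding_compose)
    fix x q assume "x \<in> Domain f" "names_vec q x"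
    from val[OF this] show "\<exists>y\<in>g `` {x}. machine_value A (rounding_compose CARD('n) M) q y"
      unfolding machine_value_def using outputs_rounding_compose[OF tm] by blast
  qed
  moreover have "compact (g `` S)" if S: "S \<subseteq> Domain f" "compact S" for S
    unfolding compact_def
  proof (intro allI impI)
    fix Y :: "nat \<Rightarrow> real" assume "\<forall>k. Y k \<in> g `` S"
    then have "\<forall>k. \<exists>x a. x \<in> S \<and> names_vec a x \<and> grid_name e a \<and> machine_value A M a (Y k)"
      unfolding g_def by blast
    then obtain X a where X: "\<And>k. X k \<in> S" "\<And>k. names_vec (a k) (X k)" "\<And>k. grid_name e (a k)"
      and Y: "\<And>k. machine_value A M (a k) (Y k)"
      by metis
    obtain r x b where r: "strict_mono r" and x: "x \<in> S" "names_vec b x"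
      and b: "\<And>n. \<forall>\<^sub>F k in sequentially. a (r k) n = b n"
      using names_subsequence[where X = X and a = a, OF S(2) X] by blast
    have "grid_name e b"
      unfolding grid_name_def
    proof
      fix n
      obtain k where "a (r k) n = b n" using b[of n] eventually_happens by fastforce
      with X(3)[of "r k"] show "\<forall>i. \<exists>z::int. b n $ i = of_int z / 2 ^ e n i"
        unfolding grid_name_def by metis
    qed
    \<comment> \<open>Correctness of the machine on the limit name supplies a value in
      \<open>f\<close>; by continuity it is the limit of the subsequence of
      \<open>Y\<close>.\<close>
    moreover obtain y where y: "y \<in> f `` {x}" "machine_value A M b y"
      using M x S(1) unfolding computes_def by blast
    ultimately have "y \<in> g `` S" using x unfolding g_def by blast
    moreover have "(Y \<circ> r) \<longlonglongrightarrow> y"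
      unfolding comp_def by (rule machine_value_continuous[OF y(2) Y b])
    ultimately show "\<exists>l\<in>g `` S. \<exists>r. strict_mono r \<and> (Y \<circ> r) \<longlonglongrightarrow> l"
      using r by blast
  qed
  ultimately show ?thesis
    using dom unfolding computable_relative_to_iff maps_compact_to_compact_def by metis
qed


section \<open>Computability implies Henkin continuity\<close>

text \<open>Failure for every \<open>N\<close> yields pairs of names that agree longer and longer. A
  limit of the first names is then also one of the second, and both sequences of values converge to
  the value at the common limit.\<close>

lemma uniform_modulus:
  fixes f :: "((real ^ 'n) \<times> real) set"
  assumes K: "compact (Domain f)" and M: "computes A M f"
  shows "\<exists>N. \<forall>x a y a' y'. x \<in> Domain f \<and> names_vec a x \<and> grid_name e a \<and> machine_value A M a y \<and>
    machine_value A M a' y' \<and> (\<forall>i<N. a' i = a i) \<longrightarrow> \<bar>y - y'\<bar> \<le> 1 / 2 ^ m"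
proof (rule ccontr)
  assume "\<not> ?thesis"
  then have "\<forall>N. \<exists>x a y a' y'. x \<in> Domain f \<and> names_vec a x \<and> grid_name e a \<and> machine_value A M a y \<and>
    machine_value A M a' y' \<and> (\<forall>i<N. a' i = a i) \<and> \<not> \<bar>y - y'\<bar> \<le> 1 / 2 ^ m" by blast
  then obtain X a Y a' Y' where X: "\<And>N. X N \<in> Domain f" "\<And>N. names_vec (a N) (X N)" "\<And>N. grid_name e (a N)"
    and Y: "\<And>N. machine_value A M (a N) (Y N)" "\<And>N. machine_value A M (a' N) (Y' N)"
    and eq: "\<And>N i. i < N \<Longrightarrow> a' N i = a N i" and far: "\<And>N. \<not> \<bar>Y N - Y' N\<bar> \<le> 1 / 2 ^ m"
    by metis
  obtain r x b where r: "strict_mono r" and x: "x \<in> Domain f" "names_vec b x"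
      and b: "\<And>n. \<forall>\<^sub>F k in sequentially. a (r k) n = b n"
    using names_subsequence[where X = X and a = a, OF K X] by blast
  have b': "\<forall>\<^sub>F k in sequentially. a' (r k) n = b n" for n
    using b[of n] eventually_gt_at_top[of n]
  proof eventually_elim
    case (elim k)
    have "n < r k" using elim(2) seq_suble[OF r, of k] by linarith
    with eq elim(1) show ?case by metis
  qed
  obtain y where y: "machine_value A M b y"
    using M x unfolding computes_def by blast
  have "(\<lambda>k. \<bar>Y (r k) - Y' (r k)\<bar>) \<longlonglongrightarrow> \<bar>y - y\<bar>"
    by (intro tendsto_intros machine_value_continuous[OF y Y(1) b] machine_value_continuous[OF y Y(2) b'])
  then have "\<forall>\<^sub>F k in sequentially. \<bar>Y (r k) - Y' (r k)\<bar> < 1 / 2 ^ m"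
    by (rule order_tendstoD) simp
  then obtain k where "\<bar>Y (r k) - Y' (r k)\<bar> < 1 / 2 ^ m"
    using eventually_happens by fastforce
  with far[of "r k"] show False by linarith
qed

section \<open>Names that follow the moves of the opponent\<close>

definition dyadic_name :: "real ^ 'n \<Rightarrow> nat \<Rightarrow> rat ^ 'n" where
  "dyadic_name x n = (\<chi> i. of_int (round (x $ i * 2 ^ n)) / 2 ^ n)"

text \<open>Nearest multiples use only half of the tolerance; the rest is the allowance for later
  moves.\<close>

lemma dyadic_name_error: "\<bar>x $ i - of_rat (dyadic_name x n $ i)\<bar> \<le> 1 / 2 ^ n * (1 / 2)"
proof -
  have "\<bar>of_int (round (x $ i * 2 ^ n)) - x $ i * 2 ^ n\<bar> / 2 ^ n \<le> (1 / 2) / 2 ^ n"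
    by (intro divide_right_mono of_int_round_abs_le) simp
  also have "\<bar>of_int (round (x $ i * 2 ^ n)) - x $ i * 2 ^ n\<bar> / 2 ^ n =
      \<bar>(of_int (round (x $ i * 2 ^ n)) - x $ i * 2 ^ n) / 2 ^ n\<bar>"
    by simp
  also have "\<dots> = \<bar>x $ i - of_rat (dyadic_name x n $ i)\<bar>"
    by (simp add: dyadic_name_def of_rat_divide of_rat_power diff_divide_distrib abs_minus_commute)
  finally show ?thesis by simp
qed

text \<open>
  The argument lists the moves in reverse order.  After \<open>l\<close> moves the error of the \<open>n\<close>-th entry is at
  most \<open>2\<^sup>-\<^sup>n\<close> times \<open>1 - 2\<^sup>-\<^sup>l\<close>, so the entries that are kept stay valid for the next move.
\<close>

primrec track_name :: "(nat \<Rightarrow> nat) \<Rightarrow> (real ^ 'n) list \<Rightarrow> nat \<Rightarrow> rat ^ 'n" where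
  "track_name N [] = dyadic_name 0"
| "track_name N (x # r) =
     (\<lambda>n. if r \<noteq> [] \<and> dist (hd r) x \<le> 1 / 2 ^ (N (length r) + length r + 1) \<and> n < N (length r)
          then track_name N r n else dyadic_name x n)"

lemma grid_track_name: "grid_name (\<lambda>n i. n) (track_name N (r :: (real ^ 'n) list))"
proof (induction r)
  have dyadic: "\<exists>z::int. dyadic_name x n $ i = of_int z / 2 ^ n" for x :: "real ^ 'n" and n i
    unfolding dyadic_name_def by auto
  {
    case Nil
    show ?case unfolding grid_name_def track_name.simps using dyadic by blast
  next
    case (Cons x r)
    show ?case
      unfolding grid_name_def
    proof (intro allI)
      fix n i
      have "track_name N (x # r) n = track_name N r n \<or> track_name N (x # r) n = dyadic_name x n" by simp
      then show "\<exists>z::int. track_name N (x # r) n $ i = of_int z / 2 ^ n"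
      proof
        assume eq: "track_name N (x # r) n = track_name N r n"
        show ?thesis unfolding eq using Cons[unfolded grid_name_def] by blast
      next
        assume eq: "track_name N (x # r) n = dyadic_name x n"
        show ?thesis unfolding eq by (rule dyadic)
      qed
    qed
  }
qed

lemma track_name_error:
  "r \<noteq> [] \<Longrightarrow> \<bar>hd r $ i - of_rat (track_name N r n $ i)\<bar> \<le> 1 / 2 ^ n * (1 - 1 / 2 ^ length r)"
proof (induction r)
  case (Cons x r)
  let ?l = "length r"
  show ?case
  proof (cases "r \<noteq> [] \<and> dist (hd r) x \<le> 1 / 2 ^ (N ?l + ?l + 1) \<and> n < N ?l")
    case True
    have "\<bar>(hd r - x) $ i\<bar> \<le> dist (hd r) x"
      unfolding dist_norm by (rule component_le_norm_cart)
    also have "\<dots> \<le> 1 / 2 ^ (N ?l + ?l + 1)" using True by blast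
    \<comment> \<open>A kept entry has an index \<open>n\<close> below \<open>N ?l\<close>, so the
      permitted distance is small relative to its tolerance \<open>1 / 2 ^ n\<close>.\<close>
    also have "\<dots> \<le> 1 / 2 ^ (n + ?l + 1)"
      using True by (intro divide_left_mono power_increasing) auto
    finally have 1: "\<bar>hd r $ i - x $ i\<bar> \<le> 1 / 2 ^ (n + ?l + 1)" by simp
    have 2: "\<bar>hd r $ i - of_rat (track_name N r n $ i)\<bar> \<le> 1 / 2 ^ n * (1 - 1 / 2 ^ ?l)"
      using True Cons.IH by blast
    \<comment> \<open>This move spends the fraction \<open>1 / 2 ^ (?l + 1)\<close> of the
      tolerance; over all moves these fractions never exhaust it.\<close>
    have 3: "1 / 2 ^ n * (1 - 1 / 2 ^ ?l) + 1 / 2 ^ (n + ?l + 1) = 1 / 2 ^ n * (1 - 1 / (2::real) ^ Suc ?l)"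
      by (simp add: power_add field_simps)
    have tri: "\<bar>u - c\<bar> \<le> s + t" if "\<bar>v - c\<bar> \<le> s" "\<bar>v - u\<bar> \<le> t" for u v c s t :: real
      using that by linarith
    from tri[OF 2 1] True show ?thesis unfolding 3 by simp
  next
    case False
    have "(1::real) / 2 ^ Suc ?l \<le> 1 / 2 ^ 1" by (intro divide_left_mono power_increasing) auto
    then have "(1::real) / 2 ^ n * (1 / 2) \<le> 1 / 2 ^ n * (1 - 1 / 2 ^ Suc ?l)"
      by (intro mult_left_mono) auto
    then have "\<bar>x $ i - of_rat (dyadic_name x n $ i)\<bar> \<le> 1 / 2 ^ n * (1 - 1 / 2 ^ Suc ?l)"
      using dyadic_name_error[of x i n] by linarith
    with False show ?thesis by auto
  qed
qed simp

lemma names_track_name: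
  assumes "r \<noteq> []"
  shows "names_vec (track_name N r) (hd r)"
  unfolding names_vec_iff
proof (intro allI)
  fix n i
  have "(1::real) / 2 ^ n * (1 - 1 / 2 ^ length r) \<le> 1 / 2 ^ n * 1"
    by (intro mult_left_mono) auto
  then show "\<bar>hd r $ i - of_rat (track_name N r n $ i)\<bar> \<le> 1 / 2 ^ n"
    using track_name_error[OF assms, of i N n] by linarith
qed

lemma computable_imp_henkin:
  fixes f :: "((real ^ 'n) \<times> real) set"
  assumes K: "compact (Domain f)" and f: "relatively_computable f"
  shows "omega_henkin_continuous f"
proof -
  obtain A M where M: "computes A M f"
    using f unfolding relatively_computable_def computable_relative_to_iff by blast
  let ?e = "\<lambda>n i. n"
  obtain N where N: "\<And>m x a y a' y'. x \<in> Domain f \<Longrightarrow> names_vec a x \<Longrightarrow> grid_name ?e a \<Longrightarrow>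
      machine_value A M a y \<Longrightarrow> machine_value A M a' y' \<Longrightarrow> (\<And>i. i < N m \<Longrightarrow> a' i = a i) \<Longrightarrow>
      \<bar>y - y'\<bar> \<le> 1 / 2 ^ m"
    using uniform_modulus[OF K M, of ?e] by metis
  define V where "V x a = (SOME y. y \<in> f `` {x} \<and> machine_value A M a y)" for x and a :: "nat \<Rightarrow> rat ^ 'n"
  have V: "V x a \<in> f `` {x} \<and> machine_value A M a (V x a)" if "x \<in> Domain f" "names_vec a x" for x a
    unfolding V_def by (rule someI_ex) (use M that in \<open>auto simp: computes_def\<close>)
  define \<delta> where "\<delta> l = 1 / (2::real) ^ (N l + l + 1)" for l
  define \<eta> where "\<eta> xs = V (hd (rev xs)) (track_name N (rev xs))" for xs
  have "\<eta> (map x [1..<Suc 1]) \<in> f `` {x 1} \<and>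
    (\<forall>l\<ge>1. x (Suc l) \<in> cball (x l) (\<delta> l) \<longrightarrow>
      \<eta> (map x [1..<Suc (Suc l)]) \<in> f `` {x (Suc l)} \<inter> cball (\<eta> (map x [1..<Suc l])) (1 / 2 ^ l))"
    if x: "\<forall>l\<ge>1. x l \<in> Domain f" for x :: "nat \<Rightarrow> real ^ 'n"
  proof -
    define r where "r l = rev (map x [1..<Suc l])" for l
    have r: "r l \<noteq> []" "hd (r l) = x l" "length (r l) = l" if "l \<ge> 1" for l
      using that by (cases l; simp add: r_def)+
    have rSuc: "r (Suc l) = x (Suc l) # r l" for l
      by (simp add: r_def)
    have \<eta>: "\<eta> (map x [1..<Suc l]) = V (x l) (track_name N (r l))" if "l \<ge> 1" for l
      unfolding \<eta>_def r_def[symmetric] using r[OF that] by simp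
    have names: "names_vec (track_name N (r l)) (x l)" if "l \<ge> 1" for l
      using names_track_name[of "r l" N] r[OF that] by simp
    have val: "V (x l) (track_name N (r l)) \<in> f `` {x l}"
      "machine_value A M (track_name N (r l)) (V (x l) (track_name N (r l)))" if "l \<ge> 1" for l
      using V names[OF that] x that by blast+
    \<comment> \<open>A near move keeps the entries below \<open>N l\<close>, so the two names agree
      wherever the modulus looks.\<close>
    have "\<bar>V (x l) (track_name N (r l)) - V (x (Suc l)) (track_name N (r (Suc l)))\<bar> \<le> 1 / 2 ^ l"
      if l: "l \<ge> 1" and near: "x (Suc l) \<in> cball (x l) (\<delta> l)" for l
    proof (rule N)
      show "x l \<in> Domain f" using x l by blast
      show "names_vec (track_name N (r l)) (x l)" by (rule names[OF l])
      show "grid_name ?e (track_name N (r l))" by (rule grid_track_name)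
      show "machine_value A M (track_name N (r l)) (V (x l) (track_name N (r l)))" by (rule val(2)[OF l])
      show "machine_value A M (track_name N (r (Suc l))) (V (x (Suc l)) (track_name N (r (Suc l))))"
        by (rule val(2)) simp
      show "track_name N (r (Suc l)) i = track_name N (r l) i" if "i < N l" for i
        using near that r[OF l] unfolding rSuc \<delta>_def by simp
    qed
    then have "V (x (Suc l)) (track_name N (r (Suc l))) \<in> cball (V (x l) (track_name N (r l))) (1 / 2 ^ l)"
      if "l \<ge> 1" "x (Suc l) \<in> cball (x l) (\<delta> l)" for l
      using that by (simp add: dist_real_def)
    moreover have "\<eta> (map x [1..<Suc (Suc l)]) = V (x (Suc l)) (track_name N (r (Suc l)))"
      "V (x (Suc l)) (track_name N (r (Suc l))) \<in> f `` {x (Suc l)}" for l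
      using \<eta>[of "Suc l"] val(1)[of "Suc l"] by simp_all
    moreover have "\<eta> (map x [1..<Suc 1]) = V (x 1) (track_name N (r 1))"
      "V (x 1) (track_name N (r 1)) \<in> f `` {x 1}"
      using \<eta>[of 1] val(1)[of 1] by simp_all
    ultimately show ?thesis
      using \<eta> by (intro conjI allI impI) (simp_all only: Int_iff simp_thms)
  qed
  moreover have "\<delta> l > 0" for l unfolding \<delta>_def by simp
  ultimately show ?thesis
    unfolding omega_henkin_continuous_def Let_def by blast
qed


section \<open>Henkin continuity implies computability\<close>

lemma henkin_imp_computable:
  fixes f :: "((real ^ 'n) \<times> real) set"
  assumes f: "maps_compact_to_compact f" "omega_henkin_continuous f"
  shows "relatively_computable f"
proof -
  obtain \<delta> :: "nat \<Rightarrow> real" and \<eta> :: "(real ^ 'n) list \<Rightarrow> real"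
    where \<delta>: "\<And>l. l \<ge> 1 \<Longrightarrow> \<delta> l > 0"
      and game: "\<And>x l. (\<forall>l\<ge>1. x l \<in> Domain f) \<Longrightarrow> l \<ge> 1 \<Longrightarrow> x (Suc l) \<in> cball (x l) (\<delta> l) \<Longrightarrow>
        \<eta> (map x [1..<Suc (Suc l)]) \<in> f `` {x (Suc l)} \<inter> cball (\<eta> (map x [1..<Suc l])) (1 / 2 ^ l)"
    using f(2) unfolding omega_henkin_continuous_def Let_def by blast
  define d where "d = real CARD('n)"
  \<comment> \<open>Two points with a common approximation differ by at most
    \<open>2 / 2 ^ e\<close> in each coordinate, and the factor \<open>d\<close> passes to the
    Euclidean norm. Half of each \<open>\<delta>\<close> leaves room for the triangle inequality
    between consecutive points.\<close>
  have "\<exists>e. d * (2 / 2 ^ e) \<le> \<delta> l / 2 \<and> d * (2 / 2 ^ e) \<le> \<delta> (Suc l) / 2" if "l \<ge> 1" for l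
  proof -
    define c where "c = min (\<delta> l) (\<delta> (Suc l)) / (4 * d)"
    have d: "d > 0" unfolding d_def by simp
    then have "c > 0" unfolding c_def using \<delta>[of l] \<delta>[of "Suc l"] that by simp
    then obtain e where "(1/2) ^ e < c" using real_arch_pow_inv[of c "1/2"] by auto
    then have "d * (2 / 2 ^ e) \<le> min (\<delta> l) (\<delta> (Suc l)) / 2"
      using d unfolding c_def by (simp add: power_divide field_simps)
    then show ?thesis by (intro exI[of _ e]) linarith
  qed
  then obtain e0 where e0: "\<And>l. l \<ge> 1 \<Longrightarrow> d * (2 / 2 ^ e0 l) \<le> \<delta> l / 2 \<and> d * (2 / 2 ^ e0 l) \<le> \<delta> (Suc l) / 2"
    by metis
  \<comment> \<open>\<open>X q l\<close> has to be close to \<open>x\<close> on the scale of both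
    \<open>\<delta> l\<close> and \<open>\<delta> (l - 1)\<close>. For \<open>l = 1\<close> the
    value \<open>e0 0\<close> is arbitrary; the maximum can only increase the precision.\<close>
  define e where "e l = max (e0 l) (e0 (l - 1))" for l
  have mono: "d * (2 / 2 ^ k') \<le> d * (2 / 2 ^ k)" if "k \<le> k'" for k k'
    using that unfolding d_def by (intro mult_left_mono divide_left_mono power_increasing) auto
  have e: "d * (2 / 2 ^ e l) \<le> \<delta> l / 2" "d * (2 / 2 ^ e (Suc l)) \<le> \<delta> l / 2" if "l \<ge> 1" for l
    using e0[OF that] mono[of "e0 l" "e l"] mono[of "e0 l" "e (Suc l)"] unfolding e_def by auto
  \<comment> \<open>The point depends on \<open>q\<close> through one entry only. If
    \<open>q\<close> names a point of the domain, that point shows that a choice exists.\<close>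
  define X where "X q l = (SOME z. z \<in> Domain f \<and> (\<forall>i. \<bar>z $ i - of_rat (q (e l) $ i)\<bar> \<le> 1 / 2 ^ e l))"
    for q :: "nat \<Rightarrow> rat ^ 'n" and l
  \<comment> \<open>The answer at \<open>m + 2\<close> is within \<open>2 / 2 ^ (m + 2)\<close> of
    the limit, which is half of the tolerance \<open>1 / 2 ^ m\<close>; the rational takes the other
    half.\<close>
  define p where "p q m = (SOME r::rat. \<bar>of_rat r - \<eta> (map (X q) [1..<Suc (m + 2)])\<bar> \<le> 1 / 2 ^ Suc m)" for q m
  \<comment> \<open>A sum bounds all exponents up to \<open>m + 2\<close> and is monotone in
    \<open>m\<close>; the successor makes the bound strict.\<close>
  define h where "h m = Suc (sum e {..m + 2})" for m
  have local: "p q m = p q' m" if "\<And>i. i < h m \<Longrightarrow> q i = q' i" for q q' m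
  proof -
    have "X q l = X q' l" if "l \<in> set [1..<Suc (m + 2)]" for l
    proof -
      have "e l \<le> sum e {..m + 2}" using that by (intro member_le_sum) auto
      then show ?thesis unfolding X_def using \<open>\<And>i. i < h m \<Longrightarrow> q i = q' i\<close>[of "e l"] by (simp add: h_def)
    qed
    then have "map (X q) [1..<Suc (m + 2)] = map (X q') [1..<Suc (m + 2)]" by (intro map_cong) auto
    then show ?thesis unfolding p_def by (simp only:)
  qed
  have "mono h" unfolding h_def by (intro monoI Suc_le_mono[THEN iffD2] sum_mono2) auto
  from local_function_computable[of h p, OF local this] obtain A M where
    M: "turing_machine M" "\<And>q. outputs A M (name_code q) (p q)" by blast
  have "\<exists>y\<in>f `` {x}. names_real (p q) y" if x: "x \<in> Domain f" and q: "names_vec q x" for x q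
  proof -
    let ?X = "X q"
    have X: "?X l \<in> Domain f" "\<And>i. \<bar>?X l $ i - of_rat (q (e l) $ i)\<bar> \<le> 1 / 2 ^ e l" for l
    proof -
      have "?X l \<in> Domain f \<and> (\<forall>i. \<bar>?X l $ i - of_rat (q (e l) $ i)\<bar> \<le> 1 / 2 ^ e l)"
        unfolding X_def by (rule someI[of _ x]) (use x q in \<open>auto simp: names_vec_iff\<close>)
      then show "?X l \<in> Domain f" "\<And>i. \<bar>?X l $ i - of_rat (q (e l) $ i)\<bar> \<le> 1 / 2 ^ e l" by auto
    qed
    have dist: "dist (?X l) x \<le> d * (2 / 2 ^ e l)" for l
    proof -
      have "\<bar>(?X l - x) $ i\<bar> \<le> 1 / 2 ^ e l + 1 / 2 ^ e l" for i
      proof -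
        have "\<bar>x $ i - of_rat (q (e l) $ i)\<bar> \<le> 1 / 2 ^ e l" using q unfolding names_vec_iff by blast
        with X(2)[of l i] show ?thesis unfolding vector_minus_component by linarith
      qed
      then have "(\<Sum>i\<in>UNIV. \<bar>(?X l - x) $ i\<bar>) \<le> (\<Sum>i\<in>(UNIV::'n set). 1 / 2 ^ e l + 1 / 2 ^ e l)"
        by (intro sum_mono)
      then have "norm (?X l - x) \<le> (\<Sum>i\<in>(UNIV::'n set). 1 / 2 ^ e l + 1 / 2 ^ e l)"
        using norm_le_l1_cart[of "?X l - x"] by linarith
      then show ?thesis by (simp add: dist_norm d_def)
    qed
    have near: "dist (?X l) x \<le> \<delta> l / 2" "dist (?X (Suc l)) x \<le> \<delta> l / 2" if "l \<ge> 1" for l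
      using dist[of l] dist[of "Suc l"] e[OF that] by linarith+
    define y where "y l = \<eta> (map ?X [1..<Suc l])" for l
    have step: "\<bar>y (Suc l) - y l\<bar> \<le> 1 / 2 ^ l" if l: "l \<ge> 1" for l
    proof -
      have "dist (?X l) (?X (Suc l)) \<le> \<delta> l"
        using near[OF l] dist_triangle2[of "?X l" "?X (Suc l)" x] by linarith
      then have "y (Suc l) \<in> cball (y l) (1 / 2 ^ l)"
        using game[of ?X l] X(1) l unfolding y_def by simp
      then show ?thesis by (simp add: dist_real_def abs_minus_commute)
    qed
    \<comment> \<open>Subtracting the remaining geometric tail makes the estimate inductive.\<close>
    have tail: "\<bar>y (l + k) - y l\<bar> \<le> 2 / 2 ^ l - 2 / 2 ^ (l + k)" if l: "l \<ge> 1" for l k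
    proof (induction k)
      case (Suc k)
      have "\<bar>y (l + Suc k) - y (l + k)\<bar> \<le> 1 / 2 ^ (l + k)" using step[of "l + k"] l by simp
      moreover have "1 / 2 ^ (l + k) = 2 / 2 ^ (l + k) - 2 / (2::real) ^ (l + Suc k)" by simp
      ultimately show ?case using Suc by linarith
    qed simp
    have tail': "\<bar>y (l + k) - y l\<bar> \<le> 2 / 2 ^ l" if "l \<ge> 1" for l k
    proof -
      have "(0::real) \<le> 2 / 2 ^ (l + k)" by simp
      with tail[OF that, of k] show ?thesis by linarith
    qed
    have null: "(\<lambda>l. 2 / (2::real) ^ l) \<longlonglongrightarrow> 0"
      using LIMSEQ_divide_realpow_zero[of 2 2] by simp
    have "Cauchy y"
    proof (rule metric_CauchyI)
      fix \<epsilon> :: real assume "\<epsilon> > 0"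
      then have "\<forall>\<^sub>F l in sequentially. 2 / (2::real) ^ l < \<epsilon> / 2 \<and> l \<ge> 1"
        using order_tendstoD(2)[OF null, of "\<epsilon> / 2"] eventually_ge_at_top[of 1] by (auto intro: eventually_conj)
      then obtain l where l: "2 / (2::real) ^ l < \<epsilon> / 2" "l \<ge> 1" using eventually_happens by fastforce
      have "dist (y m) (y n) < \<epsilon>" if "m \<ge> l" "n \<ge> l" for m n
        using tail'[OF l(2), of "m - l"] tail'[OF l(2), of "n - l"] that l(1)
        unfolding dist_real_def by simp
      then show "\<exists>l. \<forall>m\<ge>l. \<forall>n\<ge>l. dist (y m) (y n) < \<epsilon>" by blast
    qed
    then obtain Y where Y: "y \<longlonglongrightarrow> Y" using Cauchy_convergent convergent_def by blast
    have YY: "\<bar>Y - y l\<bar> \<le> 2 / 2 ^ l" if "l \<ge> 1" for l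
    proof (rule tendsto_upperbound)
      show "(\<lambda>k. \<bar>y (k + l) - y l\<bar>) \<longlonglongrightarrow> \<bar>Y - y l\<bar>"
        by (intro tendsto_intros LIMSEQ_ignore_initial_segment Y)
      show "\<forall>\<^sub>F k in sequentially. \<bar>y (k + l) - y l\<bar> \<le> 2 / 2 ^ l"
        using tail'[OF that] by (auto simp: add.commute)
    qed simp
    text \<open>If the opponent plays \<open>x\<close> in the next move, the strategy has to answer in \<open>f x\<close>.\<close>
    define z where "z l = \<eta> (map ?X [1..<Suc l] @ [x])" for l
    have z: "z l \<in> f `` {x} \<and> \<bar>z l - y l\<bar> \<le> 1 / 2 ^ l" if l: "l \<ge> 1" for l
    proof -
      \<comment> \<open>After move \<open>l\<close> the opponent repeats \<open>x\<close> forever,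
        which gives a complete sequence of moves in the domain.\<close>
      define x' where "x' j = (if j \<le> l then ?X j else x)" for j
      have 1: "map x' [1..<Suc l] = map ?X [1..<Suc l]" by (rule map_cong) (auto simp: x'_def)
      have "map x' [1..<Suc (Suc l)] = map x' [1..<Suc l] @ [x' (Suc l)]" by simp
      then have 2: "map x' [1..<Suc (Suc l)] = map ?X [1..<Suc l] @ [x]"
        unfolding 1 by (simp add: x'_def)
      have "x' (Suc l) \<in> cball (x' l) (\<delta> l)"
        using near(1)[OF l] \<delta>[OF l] by (simp add: x'_def)
      from game[of x' l, OF _ l this] X(1) x
      have "z l \<in> f `` {x} \<inter> cball (y l) (1 / 2 ^ l)"
        unfolding 1 2 z_def[symmetric] y_def[symmetric] by (simp add: x'_def)
      then show ?thesis by (simp add: dist_real_def abs_minus_commute)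
    qed
    have zlim: "z \<longlonglongrightarrow> Y"
    proof -
      have "(\<lambda>l. z l - y l) \<longlonglongrightarrow> 0"
      proof (rule Lim_null_comparison)
        show "\<forall>\<^sub>F l in sequentially. norm (z l - y l) \<le> 2 / 2 ^ l"
          using eventually_ge_at_top[of 1]
        proof eventually_elim
          case (elim l)
          have "1 / (2::real) ^ l \<le> 2 / 2 ^ l" by (simp add: divide_right_mono)
          with z[OF elim] show ?case unfolding real_norm_def by linarith
        qed
      qed (rule null)
      from tendsto_add[OF this Y] show ?thesis by simp
    qed
    \<comment> \<open>A single point is compact, so its image is closed and contains the limit of
      the answers.\<close>
    have "compact (f `` {x})"
      using f(1)[unfolded maps_compact_to_compact_def, rule_format, of "{x}"] x by simp
    then have "closed (f `` {x})" by (rule compact_imp_closed)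
    moreover have "\<forall>\<^sub>F l in sequentially. z l \<in> f `` {x}"
      using eventually_ge_at_top[of 1] by eventually_elim (use z in blast)
    ultimately have "Y \<in> f `` {x}"
      using Lim_in_closed_set zlim trivial_limit_sequentially by blast
    moreover have "names_real (p q) Y"
      unfolding names_real_def
    proof
      fix m
      obtain r where "y (m + 2) < of_rat r" "of_rat r < y (m + 2) + 1 / 2 ^ Suc m"
        using of_rat_dense[of "y (m + 2)" "y (m + 2) + 1 / 2 ^ Suc m"] by auto
      then have "\<bar>of_rat r - y (m + 2)\<bar> \<le> 1 / 2 ^ Suc m" by linarith
      then have "\<bar>of_rat (p q m) - y (m + 2)\<bar> \<le> 1 / 2 ^ Suc m"
        unfolding p_def y_def[symmetric] by (rule someI)
      moreover have "\<bar>Y - y (m + 2)\<bar> \<le> 1 / 2 ^ Suc m" using YY[of "m + 2"] by simp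
      moreover have "1 / 2 ^ m = 1 / 2 ^ Suc m + 1 / (2::real) ^ Suc m" by simp
      ultimately show "\<bar>Y - of_rat (p q m)\<bar> \<le> 1 / 2 ^ m" by linarith
    qed
    ultimately show ?thesis by blast
  qed
  then have "computes A M f"
    unfolding computes_def machine_value_def using M by blast
  then show ?thesis unfolding relatively_computable_def computable_relative_to_iff by blast
qed

theorem theorem28:
  fixes K :: "(real ^ 'n) set"
  assumes "compact K"
  shows
    "(\<forall>(f :: ((real ^ 'n) \<times> real) set) A.
        Domain f = K \<and> computable_relative_to A f \<longrightarrow>
        (\<exists>g. Domain g = K \<and> tightens g f \<and> computable_relative_to A g \<and>
             maps_compact_to_compact g)) \<and>
     (\<forall>f :: ((real ^ 'n) \<times> real) set.
        Domain f = K \<and> relatively_computable f \<longrightarrow> omega_henkin_continuous f) \<and>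
     (\<forall>f :: ((real ^ 'n) \<times> real) set.
        Domain f = K \<and> maps_compact_to_compact f \<and> omega_henkin_continuous f \<longrightarrow>
        relatively_computable f)"
proof (intro conjI allI impI; elim conjE)
  fix f :: "((real ^ 'n) \<times> real) set" and A
  assume "Domain f = K" "computable_relative_to A f"
  then show "\<exists>g. Domain g = K \<and> tightens g f \<and> computable_relative_to A g \<and> maps_compact_to_compact g"
    using tightening by blast
next
  fix f :: "((real ^ 'n) \<times> real) set"
  assume "Domain f = K" "relatively_computable f"
  then show "omega_henkin_continuous f" using computable_imp_henkin assms by blast
next
  fix f :: "((real ^ 'n) \<times> real) set"
  assume "maps_compact_to_compact f" "omega_henkin_continuous f"
  then show "relatively_computable f" by (rule henkin_imp_computable)
qed

end
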